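(* Let $n$ be even. Then: (i) the number of species containing symmetric unipotent Latin squares of order $n$ equals the number of isotopism classes containing symmetric unipotent Latin squares of order $n$; (ii) the number of rrs-isotopism classes containing symmetric unipotent Latin squares of order $n$ equals the number of isomorphism classes of $1$-factorisations of the complete graph $K_n$; (iii) if $n\equiv 2\pmod 4$, then the number of species containing symmetric unipotent Latin squares of order $n$ equals the number of rrs-isotopism classes containing symmetric unipotent Latin squares of order $n$; (iv) the number of symmetric unipotent reduced Latin squares of order $n$ equals the number of symmetric idempotent Latin squares of order $n-1$, which in turn equals the number of symmetric reduced Latin squares of order $n-1$; (v) the number of symmetric unipotent Latin squares of order $n$ equals $n!$ times the number of symmetric reduced Latin squares of order $n-1$; (vi) the number of totally symmetric unipotent reduced Latin squares of order $n$ equals the number of totally symmetric idempotent Latin squares of order $n-1$; (vii) the number of isomorphism classes of symmetric unipotent Latin squares of order $n$ equals the number of isomorphism classes of symmetric Latin squares of order $n-1$; (viii) every species, isotopism class and rrs-isotopism class that contains a symmetric unipotent Latin square of order $n$ also contains a symmetric unipotent reduced Latin square.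
   Context: A Latin square of order $n$ is a set of $n^2$ triples (row, column, symbol) over $\{1,\dots,n\}$, distinct triples agreeing in at most one coordinate. It is symmetric if it equals its transpose; totally symmetric if it is unchanged by every uniform permutation of the three coordinates of its triples; reduced if its first row and column are $1,\dots,n$ in order; unipotent if all main diagonal entries are equal; idempotent if cell $(i,i)$ contains $i$ for all $i$. An isotopism $(\alpha,\beta,\gamma)\in\mathcal{S}_n^3$ maps $(r,c,s)$ to $(r^\alpha,c^\beta,s^\gamma)$; it is an rrs-isotopism if $\alpha=\beta$ and an isomorphism if $\alpha=\beta=\gamma$. A paratopism is an isotopism combined with a uniform permutation of the triple coordinates; species are paratopism classes. A class "containing" squares with a property means one containing at least one such square. A $1$-factorisation of $K_n$ is a partition of its edges into perfect matchings; two are isomorphic if a vertex bijection maps one to the other. *)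

theory Defs
  imports "HOL-Combinatorics.Permutations" "HOL-Library.Disjoint_Sets"
begin

type_synonym triple = "nat \<times> nat \<times> nat"

text \<open>Coordinates of a triple (row, column, symbol) are numbered 1, 2, 3.\<close>

definition coord :: "triple \<Rightarrow> nat \<Rightarrow> nat" where
  "coord t i = (case t of (r, c, s) \<Rightarrow> if i = 1 then r else if i = 2 then c else s)"

definition permute_coords :: "(nat \<Rightarrow> nat) \<Rightarrow> triple \<Rightarrow> triple" where
  "permute_coords \<sigma> t = (coord t (\<sigma> 1), coord t (\<sigma> 2), coord t (\<sigma> 3))"

definition latin_square :: "nat \<Rightarrow> triple set \<Rightarrow> bool" where
  "latin_square n L \<longleftrightarrow>
     L \<subseteq> {1..n} \<times> {1..n} \<times> {1..n} \<and> card L = n ^ 2 \<and>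
     (\<forall>t\<in>L. \<forall>u\<in>L. t \<noteq> u \<longrightarrow> card {i \<in> {1, 2, 3}. coord t i = coord u i} \<le> 1)"

definition transpose_ls :: "triple set \<Rightarrow> triple set" where
  "transpose_ls L = (\<lambda>(r, c, s). (c, r, s)) ` L"

definition symmetric_ls :: "triple set \<Rightarrow> bool" where
  "symmetric_ls L \<longleftrightarrow> transpose_ls L = L"

definition totally_symmetric_ls :: "triple set \<Rightarrow> bool" where
  "totally_symmetric_ls L \<longleftrightarrow> (\<forall>\<sigma>. \<sigma> permutes {1, 2, 3} \<longrightarrow> permute_coords \<sigma> ` L = L)"

definition reduced_ls :: "nat \<Rightarrow> triple set \<Rightarrow> bool" where
  "reduced_ls n L \<longleftrightarrow> (\<forall>i\<in>{1..n}. (1, i, i) \<in> L \<and> (i, 1, i) \<in> L)"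

definition unipotent_ls :: "triple set \<Rightarrow> bool" where
  "unipotent_ls L \<longleftrightarrow> (\<forall>i j s t. (i, i, s) \<in> L \<longrightarrow> (j, j, t) \<in> L \<longrightarrow> s = t)"

definition idempotent_ls :: "nat \<Rightarrow> triple set \<Rightarrow> bool" where
  "idempotent_ls n L \<longleftrightarrow> (\<forall>i\<in>{1..n}. (i, i, i) \<in> L)"

definition isotopism :: "(nat \<Rightarrow> nat) \<Rightarrow> (nat \<Rightarrow> nat) \<Rightarrow> (nat \<Rightarrow> nat) \<Rightarrow> triple \<Rightarrow> triple" where
  "isotopism \<alpha> \<beta> \<gamma> = (\<lambda>(r, c, s). (\<alpha> r, \<beta> c, \<gamma> s))"

definition isotopic :: "nat \<Rightarrow> (triple set \<times> triple set) set" where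
  "isotopic n = {(L, L'). latin_square n L \<and> latin_square n L' \<and>
     (\<exists>\<alpha> \<beta> \<gamma>. \<alpha> permutes {1..n} \<and> \<beta> permutes {1..n} \<and> \<gamma> permutes {1..n} \<and>
        L' = isotopism \<alpha> \<beta> \<gamma> ` L)}"

definition rrs_isotopic :: "nat \<Rightarrow> (triple set \<times> triple set) set" where
  "rrs_isotopic n = {(L, L'). latin_square n L \<and> latin_square n L' \<and>
     (\<exists>\<alpha> \<gamma>. \<alpha> permutes {1..n} \<and> \<gamma> permutes {1..n} \<and> L' = isotopism \<alpha> \<alpha> \<gamma> ` L)}"

definition isomorphic :: "nat \<Rightarrow> (triple set \<times> triple set) set" where
  "isomorphic n = {(L, L'). latin_square n L \<and> latin_square n L' \<and>
     (\<exists>\<alpha>. \<alpha> permutes {1..n} \<and> L' = isotopism \<alpha> \<alpha> \<alpha> ` L)}"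

definition paratopic :: "nat \<Rightarrow> (triple set \<times> triple set) set" where
  "paratopic n = {(L, L'). latin_square n L \<and> latin_square n L' \<and>
     (\<exists>\<alpha> \<beta> \<gamma> \<sigma>. \<alpha> permutes {1..n} \<and> \<beta> permutes {1..n} \<and> \<gamma> permutes {1..n} \<and>
        \<sigma> permutes {1, 2, 3} \<and> L' = permute_coords \<sigma> ` isotopism \<alpha> \<beta> \<gamma> ` L)}"

definition species :: "nat \<Rightarrow> triple set set set" where
  "species n = {L. latin_square n L} // paratopic n"

definition isotopism_classes :: "nat \<Rightarrow> triple set set set" where
  "isotopism_classes n = {L. latin_square n L} // isotopic n"

definition rrs_isotopism_classes :: "nat \<Rightarrow> triple set set set" where
  "rrs_isotopism_classes n = {L. latin_square n L} // rrs_isotopic n"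

definition isomorphism_classes :: "nat \<Rightarrow> triple set set set" where
  "isomorphism_classes n = {L. latin_square n L} // isomorphic n"

definition complete_graph_edges :: "nat \<Rightarrow> nat set set" where
  "complete_graph_edges n = {e. e \<subseteq> {1..n} \<and> card e = 2}"

definition perfect_matching :: "nat \<Rightarrow> nat set set \<Rightarrow> bool" where
  "perfect_matching n M \<longleftrightarrow>
     M \<subseteq> complete_graph_edges n \<and> (\<forall>v\<in>{1..n}. \<exists>!e. e \<in> M \<and> v \<in> e)"

definition one_factorisation :: "nat \<Rightarrow> nat set set set \<Rightarrow> bool" where
  "one_factorisation n F \<longleftrightarrow>
     partition_on (complete_graph_edges n) F \<and> (\<forall>M\<in>F. perfect_matching n M)"

definition one_factorisation_isomorphic :: "nat \<Rightarrow> (nat set set set \<times> nat set set set) set" where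
  "one_factorisation_isomorphic n = {(F, F'). one_factorisation n F \<and> one_factorisation n F' \<and>
     (\<exists>\<phi>. bij_betw \<phi> {1..n} {1..n} \<and> F' = (\<lambda>M. (\<lambda>e. \<phi> ` e) ` M) ` F)}"

definition one_factorisation_classes :: "nat \<Rightarrow> nat set set set set set" where
  "one_factorisation_classes n = {F. one_factorisation n F} // one_factorisation_isomorphic n"

end

theory Submission imports Defs begin

text \<open>
  A symmetric square can be normalised by permuting its symbols alone, which acts freely: the
  first row can be made \<open>1, \<dots>, n\<close>, and if the order is odd, so can the diagonal, because the
  off-diagonal occurrences of a symbol pair up and hence each symbol occurs on the diagonal.
  Moving the diagonal of a symmetric square of odd order \<open>m\<close> to a new last row and column
  and filling it with a new symbol is a bijection, equivariant for \<open>S\<^sub>m\<close>, onto the symmetric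
  unipotent squares of order \<open>m + 1\<close> whose diagonal symbol is the last one.
  Each off-diagonal symbol of a symmetric unipotent square is a perfect matching, and these
  matchings determine the square up to the names of its symbols.
\<close>

section \<open>Latin squares and their equivalences\<close>

text \<open>A paratopism or isotopism between two symmetric squares need not respect their symmetry,
  so the given map cannot simply be simplified in (i) and (iii). For (i) it is composed with
  coordinate swaps that fix the squares. For (iii) the discrepancy \<theta> between its row and
  column permutations is studied; for n > 2 a nontrivial \<theta> would force 4 to divide n.
  Relabelling symbols alone is an rrs-isotopism, which serves (ii), (v) and (viii), but it is not an
  isomorphism. Hence (vii) moves the diagonal symbol by a transposition of rows, columns and symbols
  together, and rests on the fact that an isomorphism between prolonged squares cannot move the new
  point, because that point is also the diagonal symbol. The factor n! in (v) and the second
  equality in (iv) have one source: a set of squares splits into free orbits under relabelling, and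
  an orbit has one representative normalised along the first row and, for symmetric squares of odd
  order, one normalised along the diagonal.\<close>

lemma card_agree_le_1_iff:
  "card {i \<in> {1, 2, 3}. coord (r, c, s) i = coord (r', c', s') i} \<le> 1 \<longleftrightarrow>
     \<not> (r = r' \<and> c = c') \<and> \<not> (r = r' \<and> s = s') \<and> \<not> (c = c' \<and> s = s')"
proof -
  have "{i \<in> {1, 2, 3}. coord (r, c, s) i = coord (r', c', s') i} =
    (if r = r' then {1} else {}) \<union> (if c = c' then {2} else {}) \<union> (if s = s' then {3} else {})"
    by (auto simp: coord_def split: if_splits)
  then show ?thesis by simp
qed

text \<open>Once each cell holds at most one symbol, projecting triples to cells is injective, so
  having n^2 triples amounts to every cell being filled. This trades cardinalities for first-order
  conditions.\<close>

lemma latin_square_iff: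
  "latin_square n L \<longleftrightarrow>
     (\<forall>i j s. (i, j, s) \<in> L \<longrightarrow> i \<in> {1..n} \<and> j \<in> {1..n} \<and> s \<in> {1..n}) \<and>
     (\<forall>i j s s'. (i, j, s) \<in> L \<longrightarrow> (i, j, s') \<in> L \<longrightarrow> s = s') \<and>
     (\<forall>i j j' s. (i, j, s) \<in> L \<longrightarrow> (i, j', s) \<in> L \<longrightarrow> j = j') \<and>
     (\<forall>i i' j s. (i, j, s) \<in> L \<longrightarrow> (i', j, s) \<in> L \<longrightarrow> i = i') \<and>
     (\<forall>i\<in>{1..n}. \<forall>j\<in>{1..n}. \<exists>s. (i, j, s) \<in> L)"
    (is "_ \<longleftrightarrow> ?box \<and> ?u1 \<and> ?u2 \<and> ?u3 \<and> ?e")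
proof -
  have box: "L \<subseteq> {1..n} \<times> {1..n} \<times> {1..n} \<longleftrightarrow> ?box"
    by auto
  have uniq: "(\<forall>t\<in>L. \<forall>u\<in>L. t \<noteq> u \<longrightarrow> card {i \<in> {1, 2, 3}. coord t i = coord u i} \<le> 1)
      \<longleftrightarrow> ?u1 \<and> ?u2 \<and> ?u3" (is "?l \<longleftrightarrow> _")
  proof -
    have "?l \<longleftrightarrow> (\<forall>r c s r' c' s'. (r, c, s) \<in> L \<longrightarrow> (r', c', s') \<in> L \<longrightarrow>
        (r, c, s) \<noteq> (r', c', s') \<longrightarrow>
        \<not> (r = r' \<and> c = c') \<and> \<not> (r = r' \<and> s = s') \<and> \<not> (c = c' \<and> s = s'))"
      unfolding card_agree_le_1_iff[symmetric] by fastforce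
    also have "\<dots> \<longleftrightarrow> ?u1 \<and> ?u2 \<and> ?u3"
      by (auto; metis)
    finally show ?thesis .
  qed
  have card: "card L = n ^ 2 \<longleftrightarrow> ?e" if "?box" "?u1"
  proof -
    define p where "p = (\<lambda>(i, j, s). (i, j)) ` L"
    have inj: "inj_on (\<lambda>(i, j, s). (i, j)) L"
      using that(2) by (auto simp: inj_on_def)
    have sub: "p \<subseteq> {1..n} \<times> {1..n}"
      using that(1) by (auto simp: p_def)
    have "card L = card p"
      unfolding p_def by (rule card_image[OF inj, symmetric])
    moreover have "card p = n ^ 2 \<longleftrightarrow> p = {1..n} \<times> {1..n}"
      using card_subset_eq[OF _ sub] by (auto simp: power2_eq_square)
    moreover have "p = {1..n} \<times> {1..n} \<longleftrightarrow> ?e"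
    proof
      assume p: "p = {1..n} \<times> {1..n}"
      show ?e
      proof (intro ballI)
        fix i j assume "i \<in> {1..n}" "j \<in> {1..n}"
        then have "(i, j) \<in> p" using p by blast
        then show "\<exists>s. (i, j, s) \<in> L" by (auto simp: p_def)
      qed
    next
      assume ?e
      then have "(i, j) \<in> p" if "i \<in> {1..n}" "j \<in> {1..n}" for i j
        using that unfolding p_def by (metis (no_types, lifting) case_prod_conv imageI)
      then have "{1..n} \<times> {1..n} \<subseteq> p" by blast
      then show "p = {1..n} \<times> {1..n}" using sub by blast
    qed
    ultimately show ?thesis by simp
  qed
  show ?thesis
    unfolding latin_square_def box uniq using card by argo
qed

lemma latin_square_bounds:
  assumes "latin_square n L" "(i, j, s) \<in> L"
  shows "i \<in> {1..n}" "j \<in> {1..n}" "s \<in> {1..n}"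
  using assms unfolding latin_square_iff by blast+

lemma latin_square_symbol_unique:
  "latin_square n L \<Longrightarrow> (i, j, s) \<in> L \<Longrightarrow> (i, j, s') \<in> L \<Longrightarrow> s = s'"
  unfolding latin_square_iff by blast

lemma latin_square_column_unique:
  "latin_square n L \<Longrightarrow> (i, j, s) \<in> L \<Longrightarrow> (i, j', s) \<in> L \<Longrightarrow> j = j'"
  unfolding latin_square_iff by blast

lemma latin_square_row_unique:
  "latin_square n L \<Longrightarrow> (i, j, s) \<in> L \<Longrightarrow> (i', j, s) \<in> L \<Longrightarrow> i = i'"
  unfolding latin_square_iff by blast

lemma latin_square_symbol_exists:
  "latin_square n L \<Longrightarrow> i \<in> {1..n} \<Longrightarrow> j \<in> {1..n} \<Longrightarrow> \<exists>s. (i, j, s) \<in> L"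
  unfolding latin_square_iff by blast

text \<open>Row \<open>i\<close> is an injective map from columns to symbols, and an injective
  self-map of the finite set \<open>{1..n}\<close> is onto.\<close>

lemma latin_square_column_exists:
  assumes L: "latin_square n L" and i: "i \<in> {1..n}" and s: "s \<in> {1..n}"
  shows "\<exists>j. (i, j, s) \<in> L"
proof -
  define f where "f j = (THE s. (i, j, s) \<in> L)" for j
  have f: "(i, j, f j) \<in> L" if "j \<in> {1..n}" for j
    unfolding f_def
    by (rule theI')
      (use latin_square_symbol_exists[OF L i that] latin_square_symbol_unique[OF L] in blast)
  have "inj_on f {1..n}"
    using f latin_square_column_unique[OF L] unfolding inj_on_def by metis
  moreover have "f ` {1..n} \<subseteq> {1..n}"
    using f latin_square_bounds[OF L] by blast
  ultimately have "f ` {1..n} = {1..n}"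
    by (simp add: endo_inj_surj)
  then show ?thesis
    using f s by (metis imageE)
qed

lemma symmetric_ls_iff: "symmetric_ls L \<longleftrightarrow> (\<forall>i j s. (i, j, s) \<in> L \<longrightarrow> (j, i, s) \<in> L)"
proof -
  have "(i, j, s) \<in> transpose_ls L \<longleftrightarrow> (j, i, s) \<in> L" for i j s
    by (force simp: transpose_ls_def)
  then show ?thesis
    unfolding symmetric_ls_def set_eq_iff by fastforce
qed

lemma symmetric_lsD: "symmetric_ls L \<Longrightarrow> (i, j, s) \<in> L \<Longrightarrow> (j, i, s) \<in> L"
  unfolding symmetric_ls_iff by blast

section \<open>Action of isotopisms on squares\<close>

lemma mem_isotopism_image_iff:
  assumes "inj \<alpha>" "inj \<beta>" "inj \<gamma>"
  shows "(\<alpha> i, \<beta> j, \<gamma> s) \<in> isotopism \<alpha> \<beta> \<gamma> ` L \<longleftrightarrow> (i, j, s) \<in> L"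
proof
  assume "(\<alpha> i, \<beta> j, \<gamma> s) \<in> isotopism \<alpha> \<beta> \<gamma> ` L"
  then show "(i, j, s) \<in> L"
    using assms by (auto simp: isotopism_def dest!: injD)
next
  assume "(i, j, s) \<in> L"
  then show "(\<alpha> i, \<beta> j, \<gamma> s) \<in> isotopism \<alpha> \<beta> \<gamma> ` L"
    by (rule rev_image_eqI) (simp add: isotopism_def)
qed

lemma mem_isotopism_image:
  assumes "\<alpha> permutes S" "\<beta> permutes S" "\<gamma> permutes S"
  shows "(i, j, s) \<in> isotopism \<alpha> \<beta> \<gamma> ` L \<longleftrightarrow> (inv \<alpha> i, inv \<beta> j, inv \<gamma> s) \<in> L"
  using mem_isotopism_image_iff[of \<alpha> \<beta> \<gamma> "inv \<alpha> i" "inv \<beta> j" "inv \<gamma> s" L] assms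
  by (simp add: permutes_inj permutes_inverses)

lemma isotopism_image_compose:
  "isotopism \<alpha>' \<beta>' \<gamma>' ` isotopism \<alpha> \<beta> \<gamma> ` L = isotopism (\<alpha>' \<circ> \<alpha>) (\<beta>' \<circ> \<beta>) (\<gamma>' \<circ> \<gamma>) ` L"
  unfolding image_image by (rule image_cong) (auto simp: isotopism_def)

lemma isotopism_id: "isotopism id id id = id"
  by (auto simp: isotopism_def)

lemma isotopism_id_image: "isotopism id id id ` L = L"
  by (simp add: isotopism_id)

lemma latin_square_isotopism:
  assumes L: "latin_square n L"
    and p: "\<alpha> permutes {1..n}" "\<beta> permutes {1..n}" "\<gamma> permutes {1..n}"
  shows "latin_square n (isotopism \<alpha> \<beta> \<gamma> ` L)"
proof -
  have inj: "inv \<alpha> x = inv \<alpha> y \<longleftrightarrow> x = y" "inv \<beta> x = inv \<beta> y \<longleftrightarrow> x = y" "inv \<gamma> x = inv \<gamma> y \<longleftrightarrow> x = y"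
    for x y using p[THEN permutes_inv, THEN permutes_inj] by (auto simp: inj_eq)
  have bnd: "inv \<alpha> x \<in> {1..n} \<longleftrightarrow> x \<in> {1..n}" "inv \<beta> x \<in> {1..n} \<longleftrightarrow> x \<in> {1..n}"
    "inv \<gamma> x \<in> {1..n} \<longleftrightarrow> x \<in> {1..n}" for x
    using p[THEN permutes_inv, THEN permutes_in_image] by auto
  show ?thesis
    unfolding latin_square_iff mem_isotopism_image[OF p]
  proof (intro conjI allI ballI impI)
    fix i j assume "i \<in> {1..n}" "j \<in> {1..n}"
    then obtain s where "(inv \<alpha> i, inv \<beta> j, s) \<in> L"
      using latin_square_symbol_exists[OF L] bnd(1)[of i] bnd(2)[of j] by metis
    then show "\<exists>s. (inv \<alpha> i, inv \<beta> j, inv \<gamma> s) \<in> L"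
      using p(3) by (metis permutes_inverses(2))
  next
    fix i j s assume "(inv \<alpha> i, inv \<beta> j, inv \<gamma> s) \<in> L"
    from latin_square_bounds[OF L this] show "i \<in> {1..n}" "j \<in> {1..n}" "s \<in> {1..n}"
      unfolding bnd .
  next
    fix i j s s' assume "(inv \<alpha> i, inv \<beta> j, inv \<gamma> s) \<in> L" "(inv \<alpha> i, inv \<beta> j, inv \<gamma> s') \<in> L"
    from latin_square_symbol_unique[OF L this] show "s = s'" unfolding inj .
  next
    fix i j j' s assume "(inv \<alpha> i, inv \<beta> j, inv \<gamma> s) \<in> L" "(inv \<alpha> i, inv \<beta> j', inv \<gamma> s) \<in> L"
    from latin_square_column_unique[OF L this] show "j = j'" unfolding inj .
  next
    fix i i' j s assume "(inv \<alpha> i, inv \<beta> j, inv \<gamma> s) \<in> L" "(inv \<alpha> i', inv \<beta> j, inv \<gamma> s) \<in> L"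
    from latin_square_row_unique[OF L this] show "i = i'" unfolding inj .
  qed
qed

lemma symmetric_ls_isotopism:
  assumes "symmetric_ls L"
  shows "symmetric_ls (isotopism \<alpha> \<alpha> \<gamma> ` L)"
  unfolding symmetric_ls_iff
proof (intro allI impI)
  fix i j s assume "(i, j, s) \<in> isotopism \<alpha> \<alpha> \<gamma> ` L"
  then obtain i' j' s' where "(i', j', s') \<in> L" "i = \<alpha> i'" "j = \<alpha> j'" "s = \<gamma> s'"
    by (auto simp: isotopism_def)
  then show "(j, i, s) \<in> isotopism \<alpha> \<alpha> \<gamma> ` L"
    by (intro rev_image_eqI[OF symmetric_lsD[OF assms]]) (auto simp: isotopism_def)
qed

lemma unipotent_ls_isotopism:
  assumes "unipotent_ls L" "inj \<alpha>"
  shows "unipotent_ls (isotopism \<alpha> \<alpha> \<gamma> ` L)"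
  unfolding unipotent_ls_def
proof (intro allI impI)
  fix i j s t assume "(i, i, s) \<in> isotopism \<alpha> \<alpha> \<gamma> ` L" "(j, j, t) \<in> isotopism \<alpha> \<alpha> \<gamma> ` L"
  then obtain i' s' j' t' where "(i', i', s') \<in> L" "s = \<gamma> s'" "(j', j', t') \<in> L" "t = \<gamma> t'"
    using injD[OF assms(2)] by (auto simp: isotopism_def dest!: injD[OF assms(2)])
  then show "s = t"
    using assms(1) unfolding unipotent_ls_def by blast
qed

section \<open>Paratopisms with a prescribed coordinate permutation\<close>

text \<open>\<open>paratopic\<close> hides \<sigma> behind a quantifier. Here it is a parameter,
  because the proof of (i) computes with the set of those \<sigma> that lead from one square to
  another.\<close>

definition image_by :: "nat \<Rightarrow> (nat \<Rightarrow> nat) \<Rightarrow> triple set \<Rightarrow> triple set \<Rightarrow> bool" where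
  "image_by n \<sigma> L L' \<longleftrightarrow> (\<exists>\<alpha> \<beta> \<gamma>. \<alpha> permutes {1..n} \<and> \<beta> permutes {1..n} \<and> \<gamma> permutes {1..n} \<and>
     L' = permute_coords \<sigma> ` isotopism \<alpha> \<beta> \<gamma> ` L)"

lemma image_byI:
  "\<alpha> permutes {1..n} \<Longrightarrow> \<beta> permutes {1..n} \<Longrightarrow> \<gamma> permutes {1..n} \<Longrightarrow>
    image_by n \<sigma> L (permute_coords \<sigma> ` isotopism \<alpha> \<beta> \<gamma> ` L)"
  unfolding image_by_def by blast

lemma coord_permute_coords: "i \<in> {1, 2, 3} \<Longrightarrow> coord (permute_coords \<sigma> t) i = coord t (\<sigma> i)"
  by (auto simp: coord_def permute_coords_def)

text \<open>Entry i of the result is read at position \<sigma> i, so composition is contravariant;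
  this is also why \<open>image_by_trans\<close> yields \<open>\<sigma> \<circ> \<tau>\<close>. The
  values \<sigma> 1, \<sigma> 2, \<sigma> 3 have to be positions, since \<open>coord\<close> returns
  the third entry at every number other than 1 and 2.\<close>

lemma permute_coords_compose:
  assumes "\<sigma> permutes {1, 2, 3}"
  shows "permute_coords \<sigma> (permute_coords \<tau> t) = permute_coords (\<tau> \<circ> \<sigma>) t"
proof -
  have "\<sigma> 1 \<in> {1, 2, 3}" "\<sigma> 2 \<in> {1, 2, 3}" "\<sigma> 3 \<in> {1, 2, 3}"
    unfolding permutes_in_image[OF assms] by simp_all
  from this[THEN coord_permute_coords[of _ \<tau> t]] show ?thesis
    unfolding permute_coords_def[of \<sigma>] permute_coords_def[of "\<tau> \<circ> \<sigma>"] by (simp only: comp_apply)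
qed

lemma permute_coords_id: "permute_coords id t = t"
  by (cases t) (simp add: permute_coords_def coord_def)

text \<open>Coordinate permutations normalise the group of isotopisms: an isotopism moves past
  \<sigma> if its three components are rearranged. They are given as a family \<open>g\<close> so
  that they can be indexed by positions.\<close>

lemma isotopism_permute_coords:
  fixes g :: "nat \<Rightarrow> nat \<Rightarrow> nat"
  assumes "\<sigma> permutes {1, 2, 3}" "\<And>i. i \<in> {1, 2, 3} \<Longrightarrow> g i permutes S"
  obtains \<alpha> \<beta> \<gamma> where "\<alpha> permutes S" "\<beta> permutes S" "\<gamma> permutes S"
    "\<And>t. isotopism (g 1) (g 2) (g 3) (permute_coords \<sigma> t) = permute_coords \<sigma> (isotopism \<alpha> \<beta> \<gamma> t)"
proof
  \<comment> \<open>Position i after permuting is position \<sigma> i before it, so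
    \<open>g i\<close> has to act at \<sigma> i.\<close>
  let ?h = "\<lambda>i. g (inv \<sigma> i)"
  have i: "inv \<sigma> i \<in> {1, 2, 3}" if "i \<in> {1, 2, 3}" for i
    using that unfolding permutes_in_image[OF permutes_inv[OF assms(1)]] .
  show "?h 1 permutes S" "?h 2 permutes S" "?h 3 permutes S"
    by (rule assms(2)[OF i], simp)+
  have co: "coord (isotopism (k 1) (k 2) (k 3) t) i = k i (coord t i)" if "i \<in> {1, 2, 3}" for k i t
    using that by (cases t) (auto simp: coord_def isotopism_def)
  have s: "\<sigma> i \<in> {1, 2, 3}" if "i \<in> {1, 2, 3}" for i
    using that unfolding permutes_in_image[OF assms(1)] .
  have "permute_coords \<sigma> (isotopism (?h 1) (?h 2) (?h 3) t) = 
    (g 1 (coord t (\<sigma> 1)), g 2 (coord t (\<sigma> 2)), g 3 (coord t (\<sigma> 3)))" for t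
    using co[of "\<sigma> 1" ?h] co[of "\<sigma> 2" ?h] co[of "\<sigma> 3" ?h] s[of 1] s[of 2] s[of 3] permutes_inverses(2)[OF assms(1)]
    by (simp add: permute_coords_def)
  then show "isotopism (g 1) (g 2) (g 3) (permute_coords \<sigma> t)
      = permute_coords \<sigma> (isotopism (?h 1) (?h 2) (?h 3) t)" for t
    by (simp add: permute_coords_def isotopism_def)
qed

lemma image_by_trans:
  assumes "image_by n \<sigma> L L'" "image_by n \<tau> L' L''" "\<sigma> permutes {1, 2, 3}" "\<tau> permutes {1, 2, 3}"
  shows "image_by n (\<sigma> \<circ> \<tau>) L L''"
proof -
  obtain \<alpha> \<beta> \<gamma> where p: "\<alpha> permutes {1..n}" "\<beta> permutes {1..n}" "\<gamma> permutes {1..n}"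
    "L' = permute_coords \<sigma> ` isotopism \<alpha> \<beta> \<gamma> ` L"
    using assms(1) unfolding image_by_def by blast
  obtain \<alpha>' \<beta>' \<gamma>' where p': "\<alpha>' permutes {1..n}" "\<beta>' permutes {1..n}" "\<gamma>' permutes {1..n}"
    "L'' = permute_coords \<tau> ` isotopism \<alpha>' \<beta>' \<gamma>' ` L'"
    using assms(2) unfolding image_by_def by blast
  define g where "g i = (if i = 1 then \<alpha>' else if i = 2 then \<beta>' else \<gamma>')" for i :: nat
  have "g i permutes {1..n}" for i using p' by (simp add: g_def)
  then obtain \<alpha>2 \<beta>2 \<gamma>2 where q: "\<alpha>2 permutes {1..n}" "\<beta>2 permutes {1..n}" "\<gamma>2 permutes {1..n}"
    "\<And>t. isotopism (g 1) (g 2) (g 3) (permute_coords \<sigma> t) = permute_coords \<sigma> (isotopism \<alpha>2 \<beta>2 \<gamma>2 t)"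
    using isotopism_permute_coords[OF assms(3), of g "{1..n}"] by blast
  have "L'' = permute_coords (\<sigma> \<circ> \<tau>) ` isotopism \<alpha>2 \<beta>2 \<gamma>2 ` isotopism \<alpha> \<beta> \<gamma> ` L"
  proof -
    have "permute_coords \<tau> (isotopism \<alpha>' \<beta>' \<gamma>' (permute_coords \<sigma> t))
        = permute_coords (\<sigma> \<circ> \<tau>) (isotopism \<alpha>2 \<beta>2 \<gamma>2 t)" for t
      using q(4)[of t] permute_coords_compose[OF assms(4)] by (simp add: g_def)
    then show ?thesis
      unfolding p'(4) p(4) image_image by (rule image_cong[OF refl])
  qed
  then show ?thesis
    unfolding isotopism_image_compose
    using image_byI[OF permutes_compose[OF p(1) q(1)] permutes_compose[OF p(2) q(2)]
      permutes_compose[OF p(3) q(3)], of "\<sigma> \<circ> \<tau>" L] by simp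
qed

lemma image_by_id_iff:
  "image_by n id L L' \<longleftrightarrow> (\<exists>\<alpha> \<beta> \<gamma>. \<alpha> permutes {1..n} \<and> \<beta> permutes {1..n} \<and> \<gamma> permutes {1..n} \<and>
     L' = isotopism \<alpha> \<beta> \<gamma> ` L)"
proof -
  have "permute_coords id = id"
    by (rule ext) (simp add: permute_coords_id)
  then show ?thesis
    by (simp only: image_by_def image_id id_apply)
qed

text \<open>The coordinate permutation is undone first and the isotopism second, so that reordering
  the two is left to \<open>image_by_trans\<close>.\<close>

lemma image_by_sym:
  assumes "image_by n \<sigma> L L'" "\<sigma> permutes {1, 2, 3}"
  shows "image_by n (inv \<sigma>) L' L"
proof -
  obtain \<alpha> \<beta> \<gamma> where p: "\<alpha> permutes {1..n}" "\<beta> permutes {1..n}" "\<gamma> permutes {1..n}"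
    "L' = permute_coords \<sigma> ` isotopism \<alpha> \<beta> \<gamma> ` L"
    using assms(1) unfolding image_by_def by blast
  have "permute_coords (inv \<sigma>) ` isotopism id id id ` L' = isotopism \<alpha> \<beta> \<gamma> ` L"
    using permutes_inv[OF assms(2)]
    by (simp add: p(4) isotopism_id image_image permute_coords_compose permutes_inv_o(1)[OF assms(2)]
      permute_coords_id)
  then have 1: "image_by n (inv \<sigma>) L' (isotopism \<alpha> \<beta> \<gamma> ` L)"
    unfolding image_by_def using permutes_id by metis
  have "isotopism (inv \<alpha>) (inv \<beta>) (inv \<gamma>) ` isotopism \<alpha> \<beta> \<gamma> ` L = L"
    using p by (simp add: isotopism_image_compose permutes_inv_o isotopism_id_image)
  then have 2: "image_by n id (isotopism \<alpha> \<beta> \<gamma> ` L) L"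
    unfolding image_by_id_iff using p permutes_inv by metis
  show ?thesis
    using image_by_trans[OF 1 2] permutes_inv[OF assms(2)] permutes_id by simp
qed

section \<open>Equivalence relations and the comparison of class numbers\<close>

lemma equiv_restrict:
  assumes "\<And>x. P x \<Longrightarrow> Q x x" "\<And>x y. P x \<Longrightarrow> P y \<Longrightarrow> Q x y \<Longrightarrow> Q y x"
    "\<And>x y z. Q x y \<Longrightarrow> Q y z \<Longrightarrow> Q x z"
  shows "equiv {x. P x} {(x, y). P x \<and> P y \<and> Q x y}"
proof (rule equivI)
  show "refl_on {x. P x} {(x, y). P x \<and> P y \<and> Q x y}"
    using assms(1) by (auto simp: refl_on_def)
  show "sym {(x, y). P x \<and> P y \<and> Q x y}"
    using assms(2) by (auto simp: sym_def)
  show "trans {(x, y). P x \<and> P y \<and> Q x y}"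
    using assms(3) by (auto simp: trans_def)
qed auto

lemma equiv_paratopic: "equiv {L. latin_square n L} (paratopic n)"
proof -
  have "equiv {L. latin_square n L} {(L, L'). latin_square n L \<and> latin_square n L' \<and>
    (\<exists>\<sigma>. \<sigma> permutes {1, 2, 3} \<and> image_by n \<sigma> L L')}"
  proof (rule equiv_restrict)
    fix L
    have "image_by n id L L"
      unfolding image_by_id_iff using isotopism_id_image permutes_id by metis
    then show "\<exists>\<sigma>. \<sigma> permutes {1, 2, 3} \<and> image_by n \<sigma> L L"
      using permutes_id by blast
  next
    fix L L' assume "\<exists>\<sigma>. \<sigma> permutes {1, 2, 3} \<and> image_by n \<sigma> L L'"
    then show "\<exists>\<sigma>. \<sigma> permutes {1, 2, 3} \<and> image_by n \<sigma> L' L"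
      using image_by_sym permutes_inv by blast
  next
    fix L L' L'' assume "\<exists>\<sigma>. \<sigma> permutes {1, 2, 3} \<and> image_by n \<sigma> L L'"
      "\<exists>\<sigma>. \<sigma> permutes {1, 2, 3} \<and> image_by n \<sigma> L' L''"
    then obtain \<sigma> \<tau> where "\<sigma> permutes {1, 2, 3}" "image_by n \<sigma> L L'"
      "\<tau> permutes {1, 2, 3}" "image_by n \<tau> L' L''" by blast
    then show "\<exists>\<sigma>. \<sigma> permutes {1, 2, 3} \<and> image_by n \<sigma> L L''"
      using image_by_trans permutes_compose by metis
  qed
  also have "{(L, L'). latin_square n L \<and> latin_square n L' \<and>
    (\<exists>\<sigma>. \<sigma> permutes {1, 2, 3} \<and> image_by n \<sigma> L L')} = paratopic n"
    unfolding paratopic_def image_by_def by blast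
  finally show ?thesis .
qed

lemma isotopic_iff_image_by:
  "isotopic n = {(L, L'). latin_square n L \<and> latin_square n L' \<and> image_by n id L L'}"
  by (simp add: isotopic_def image_by_id_iff)

lemma equiv_isotopic: "equiv {L. latin_square n L} (isotopic n)"
  unfolding isotopic_iff_image_by
proof (rule equiv_restrict)
  show "image_by n id L L" for L
    unfolding image_by_id_iff using isotopism_id_image permutes_id by metis
  show "image_by n id L' L" if "image_by n id L L'" for L L'
    using image_by_sym[OF that] permutes_id by simp
  show "image_by n id L L''" if "image_by n id L L'" "image_by n id L' L''" for L L' L''
    using image_by_trans[OF that] permutes_id by simp
qed

lemma equiv_rrs_isotopic: "equiv {L. latin_square n L} (rrs_isotopic n)"
  unfolding rrs_isotopic_def
proof (rule equiv_restrict)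
  show "\<exists>\<alpha> \<gamma>. \<alpha> permutes {1..n} \<and> \<gamma> permutes {1..n} \<and> L = isotopism \<alpha> \<alpha> \<gamma> ` L" for L
    using isotopism_id_image permutes_id by metis
next
  fix L L' assume "\<exists>\<alpha> \<gamma>. \<alpha> permutes {1..n} \<and> \<gamma> permutes {1..n} \<and> L' = isotopism \<alpha> \<alpha> \<gamma> ` L"
  then obtain \<alpha> \<gamma> where p: "\<alpha> permutes {1..n}" "\<gamma> permutes {1..n}" "L' = isotopism \<alpha> \<alpha> \<gamma> ` L"
    by blast
  then have "L = isotopism (inv \<alpha>) (inv \<alpha>) (inv \<gamma>) ` L'"
    by (simp add: isotopism_image_compose permutes_inv_o isotopism_id_image)
  then show "\<exists>\<alpha> \<gamma>. \<alpha> permutes {1..n} \<and> \<gamma> permutes {1..n} \<and> L = isotopism \<alpha> \<alpha> \<gamma> ` L'"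
    using p permutes_inv by metis
next
  fix L L' L'' assume "\<exists>\<alpha> \<gamma>. \<alpha> permutes {1..n} \<and> \<gamma> permutes {1..n} \<and> L' = isotopism \<alpha> \<alpha> \<gamma> ` L"
    "\<exists>\<alpha> \<gamma>. \<alpha> permutes {1..n} \<and> \<gamma> permutes {1..n} \<and> L'' = isotopism \<alpha> \<alpha> \<gamma> ` L'"
  then show "\<exists>\<alpha> \<gamma>. \<alpha> permutes {1..n} \<and> \<gamma> permutes {1..n} \<and> L'' = isotopism \<alpha> \<alpha> \<gamma> ` L"
    using isotopism_image_compose permutes_compose by metis
qed

lemma equiv_isomorphic: "equiv {L. latin_square n L} (isomorphic n)"
  unfolding isomorphic_def
proof (rule equiv_restrict)
  show "\<exists>\<alpha>. \<alpha> permutes {1..n} \<and> L = isotopism \<alpha> \<alpha> \<alpha> ` L" for L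
    using isotopism_id_image permutes_id by metis
next
  fix L L' assume "\<exists>\<alpha>. \<alpha> permutes {1..n} \<and> L' = isotopism \<alpha> \<alpha> \<alpha> ` L"
  then obtain \<alpha> where p: "\<alpha> permutes {1..n}" "L' = isotopism \<alpha> \<alpha> \<alpha> ` L"
    by blast
  then have "L = isotopism (inv \<alpha>) (inv \<alpha>) (inv \<alpha>) ` L'"
    by (simp add: isotopism_image_compose permutes_inv_o isotopism_id_image)
  then show "\<exists>\<alpha>. \<alpha> permutes {1..n} \<and> L = isotopism \<alpha> \<alpha> \<alpha> ` L'"
    using p permutes_inv by metis
next
  fix L L' L'' assume "\<exists>\<alpha>. \<alpha> permutes {1..n} \<and> L' = isotopism \<alpha> \<alpha> \<alpha> ` L"
    "\<exists>\<alpha>. \<alpha> permutes {1..n} \<and> L'' = isotopism \<alpha> \<alpha> \<alpha> ` L'"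
  then show "\<exists>\<alpha>. \<alpha> permutes {1..n} \<and> L'' = isotopism \<alpha> \<alpha> \<alpha> ` L"
    using isotopism_image_compose permutes_compose by metis
qed

text \<open>Maps with the same kernel on \<open>X\<close> have images in bijection, by passing
  through a chosen preimage.\<close>

lemma card_image_eq_card_image:
  assumes "\<And>x y. x \<in> X \<Longrightarrow> y \<in> X \<Longrightarrow> g x = g y \<longleftrightarrow> h x = h y"
  shows "card (g ` X) = card (h ` X)"
proof (rule bij_betw_same_card)
  have inv: "inv_into X g c \<in> X" "g (inv_into X g c) = c" if "c \<in> g ` X" for c
    using that by (rule inv_into_into, rule f_inv_into_f)
  show "bij_betw (\<lambda>c. h (inv_into X g c)) (g ` X) (h ` X)"
  proof (rule bij_betw_imageI)
    show "inj_on (\<lambda>c. h (inv_into X g c)) (g ` X)"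
    proof (rule inj_onI)
      fix c d assume "c \<in> g ` X" "d \<in> g ` X" "h (inv_into X g c) = h (inv_into X g d)"
      then have "g (inv_into X g c) = g (inv_into X g d)"
        using assms inv(1) by blast
      then show "c = d"
        using inv(2) \<open>c \<in> g ` X\<close> \<open>d \<in> g ` X\<close> by simp
    qed
    have "h (inv_into X g (g x)) = h x" if "x \<in> X" for x
      using inv[of "g x"] assms[of "inv_into X g (g x)" x] that by blast
    then show "(\<lambda>c. h (inv_into X g c)) ` g ` X = h ` X"
      unfolding image_image by (rule image_cong[OF refl])
  qed
qed

text \<open>Serves every comparison of class numbers. \<open>P\<close> need not be invariant under
  \<open>r\<close>: a class counts as soon as it has one member with \<open>P\<close>. Therefore
  \<open>f\<close> is constrained only on such members, where it preserves and reflects the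
  relations and meets every class that contains a member with \<open>Q\<close>.\<close>

lemma card_classes_eq:
  assumes r: "equiv A r" and s: "equiv B s"
    and f: "\<And>x. x \<in> A \<Longrightarrow> P x \<Longrightarrow> f x \<in> B \<and> Q (f x)"
    and iff: "\<And>x y. x \<in> A \<Longrightarrow> y \<in> A \<Longrightarrow> P x \<Longrightarrow> P y \<Longrightarrow> (x, y) \<in> r \<longleftrightarrow> (f x, f y) \<in> s"
    and ex: "\<And>y. y \<in> B \<Longrightarrow> Q y \<Longrightarrow> \<exists>x\<in>A. P x \<and> (f x, y) \<in> s"
  shows "card {C \<in> A // r. \<exists>x\<in>C. P x} = card {C \<in> B // s. \<exists>y\<in>C. Q y}"
proof -
  have classes: "{C \<in> A // r. \<exists>x\<in>C. P x} = (\<lambda>x. r `` {x}) ` {x \<in> A. P x}"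
    if r: "equiv A r" for A :: "'c set" and r P
  proof safe
    fix C x assume "C \<in> A // r" "x \<in> C" "P x"
    moreover from this have "x \<in> A" using in_quotient_imp_subset[OF r] by blast
    ultimately show "C \<in> (\<lambda>x. r `` {x}) ` {x \<in> A. P x}"
      using r by (metis (mono_tags, lifting) Image_singleton_iff equiv_class_eq imageI mem_Collect_eq quotientE)
  next
    fix x assume "x \<in> A" "P x"
    then show "r `` {x} \<in> A // r" "\<exists>x\<in>r `` {x}. P x"
      using equiv_class_self[OF r] by (auto intro: quotientI)
  qed
  let ?X = "{x \<in> A. P x}" and ?g = "\<lambda>x. r `` {x}" and ?h = "\<lambda>x. s `` {f x}"
  have same: "?g x = ?g y \<longleftrightarrow> ?h x = ?h y" if "x \<in> ?X" "y \<in> ?X" for x y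
    using that eq_equiv_class_iff[OF r, of x y] eq_equiv_class_iff[OF s, of "f x" "f y"] f iff by auto
  have "(\<lambda>y. s `` {y}) ` {y \<in> B. Q y} = ?h ` ?X"
  proof safe
    fix y assume "y \<in> B" "Q y"
    then obtain x where "x \<in> A" "P x" "(f x, y) \<in> s" using ex by blast
    then show "s `` {y} \<in> ?h ` ?X"
      using equiv_class_eq[OF s] by blast
  qed (use f in blast)
  moreover have "card (?g ` ?X) = card (?h ` ?X)"
    by (rule card_image_eq_card_image[OF same])
  ultimately show ?thesis
    by (simp only: classes[OF r] classes[OF s])
qed

section \<open>Isotopism of symmetric unipotent squares\<close>

text \<open>The two 3-cycles are written with \<open>transpose 1 2\<close> as left factor because a
  symmetric square absorbs that factor, which leaves a transposition.\<close>

lemma permutes_123_cases: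
  assumes "\<tau> permutes {1, 2, 3::nat}"
  shows "\<tau> \<in> {id, transpose 1 2, transpose 1 3, transpose 2 3,
    transpose 1 2 \<circ> transpose 1 3, transpose 1 2 \<circ> transpose 2 3}"
proof -
  have in3: "\<tau> 1 \<in> {1, 2, 3}" "\<tau> 2 \<in> {1, 2, 3}" "\<tau> 3 \<in> {1, 2, 3}"
    unfolding permutes_in_image[OF assms] by simp_all
  have ne: "\<tau> 1 \<noteq> \<tau> 2" "\<tau> 1 \<noteq> \<tau> 3" "\<tau> 2 \<noteq> \<tau> 3"
    using permutes_inj[OF assms] by (auto simp: inj_eq)
  have eq: "\<tau> = \<rho>" if "\<rho> permutes {1, 2, 3}" "\<tau> 1 = \<rho> 1" "\<tau> 2 = \<rho> 2" "\<tau> 3 = \<rho> 3" for \<rho>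
  proof
    fix x show "\<tau> x = \<rho> x"
    proof (cases "x \<in> {1, 2, 3}")
      case True
      then show ?thesis using that by auto
    next
      case False
      then show ?thesis
        using permutes_not_in[OF assms False] permutes_not_in[OF that(1) False] by simp
    qed
  qed
  have t: "transpose 1 2 permutes {1, 2, 3::nat}" "transpose 1 3 permutes {1, 2, 3::nat}"
    "transpose 2 3 permutes {1, 2, 3::nat}"
    by (rule permutes_swap_id; simp)+
  note t' = permutes_compose[OF t(2,1)] permutes_compose[OF t(3,1)]
  consider "\<tau> 1 = 1 \<and> \<tau> 2 = 2 \<and> \<tau> 3 = 3" | "\<tau> 1 = 2 \<and> \<tau> 2 = 1 \<and> \<tau> 3 = 3"
    | "\<tau> 1 = 3 \<and> \<tau> 2 = 2 \<and> \<tau> 3 = 1" | "\<tau> 1 = 1 \<and> \<tau> 2 = 3 \<and> \<tau> 3 = 2"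
    | "\<tau> 1 = 3 \<and> \<tau> 2 = 1 \<and> \<tau> 3 = 2" | "\<tau> 1 = 2 \<and> \<tau> 2 = 3 \<and> \<tau> 3 = 1"
    using in3 ne by auto
  then show ?thesis
  proof cases
    case 1
    then show ?thesis using eq[OF permutes_id] by simp
  next
    case 2
    then show ?thesis using eq[OF t(1)] by (simp add: transpose_def)
  next
    case 3
    then show ?thesis using eq[OF t(2)] by (simp add: transpose_def)
  next
    case 4
    then show ?thesis using eq[OF t(3)] by (simp add: transpose_def)
  next
    case 5
    then show ?thesis using eq[OF t'(1)] by (simp add: transpose_def)
  next
    case 6
    then show ?thesis using eq[OF t'(2)] by (simp add: transpose_def)
  qed
qed

lemma symmetric_ls_image_by_transpose:
  assumes "symmetric_ls L"
  shows "image_by n (transpose 1 2) L L"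
proof -
  have "permute_coords (transpose 1 2) = (\<lambda>(i, j, s). (j, i, s))"
    by (auto simp: permute_coords_def coord_def transpose_def)
  then have "permute_coords (transpose 1 2) ` isotopism id id id ` L = L"
    using assms unfolding isotopism_id_image symmetric_ls_def transpose_ls_def by simp
  then show ?thesis
    using image_byI[OF permutes_id permutes_id permutes_id, of n "transpose 1 2" L] by simp
qed

text \<open>The coordinate permutations carrying a square to an isotope of itself form a subgroup of
  \<open>S\<^sub>3\<close>. If \<open>\<rho>\<close> carries \<open>L\<close> to \<open>L'\<close> and both are symmetric, that subgroup contains the
  transposition \<open>(1 2)\<close> and its conjugate under \<open>\<rho>\<close>; unless \<open>\<rho>\<close> commutes with \<open>(1 2)\<close> it is
  therefore all of \<open>S\<^sub>3\<close>.\<close>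

lemma paratopic_symmetric_imp_isotopic:
  assumes "(L, L') \<in> paratopic n" "symmetric_ls L" "symmetric_ls L'"
  shows "(L, L') \<in> isotopic n"
proof -
  let ?c = "transpose 1 2 :: nat \<Rightarrow> nat"
  obtain \<sigma> where \<sigma>: "\<sigma> permutes {1, 2, 3}" "image_by n \<sigma> L L'"
    using assms(1) unfolding paratopic_def image_by_def by blast
  note cL = symmetric_ls_image_by_transpose[OF assms(2), of n]
  note cL' = symmetric_ls_image_by_transpose[OF assms(3), of n]
  have c: "?c permutes {1, 2, 3}" "transpose 1 3 permutes {1, 2, 3::nat}"
    "transpose 2 3 permutes {1, 2, 3::nat}"
    by (rule permutes_swap_id; simp)+
  \<comment> \<open>For \<rho> = (1 3) or (2 3) the product \<open>?c \<circ> \<rho>\<close> is a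
    3-cycle that leads from \<open>L\<close> to \<open>L'\<close> and also back. Going there, back
    and there again composes to its cube, the identity.\<close>
  have involution: "image_by n id L L'"
    if \<rho>: "image_by n \<rho> L L'" "\<rho> permutes {1, 2, 3}" "\<rho> \<circ> \<rho> = id"
      "(?c \<circ> \<rho>) \<circ> (?c \<circ> \<rho>) \<circ> (?c \<circ> \<rho>) = id" for \<rho>
  proof -
    have cr: "?c \<circ> \<rho> permutes {1, 2, 3}"
      by (rule permutes_compose[OF \<rho>(2) c(1)])
    have "inv \<rho> = \<rho>"
      using \<rho>(3) by (rule inv_unique_comp) (rule \<rho>(3))
    then have "image_by n \<rho> L' L"
      using image_by_sym[OF \<rho>(1,2)] by simp
    then have "image_by n (?c \<circ> \<rho>) L' L"
      by (rule image_by_trans[OF cL' _ c(1) \<rho>(2)])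
    moreover have 1: "image_by n (?c \<circ> \<rho>) L L'"
      by (rule image_by_trans[OF cL \<rho>(1) c(1) \<rho>(2)])
    ultimately have "image_by n ((?c \<circ> \<rho>) \<circ> (?c \<circ> \<rho>)) L L"
      using image_by_trans cr by blast
    then have "image_by n ((?c \<circ> \<rho>) \<circ> (?c \<circ> \<rho>) \<circ> (?c \<circ> \<rho>)) L L'"
      by (rule image_by_trans[OF _ 1 permutes_compose[OF cr cr] cr])
    then show ?thesis using \<rho>(4) by simp
  qed
  have cc: "?c \<circ> (?c \<circ> \<rho>) = \<rho>" for \<rho> :: "nat \<Rightarrow> nat"
    by (simp add: fun_eq_iff)
  have flip: "image_by n \<rho> L L'" if "\<sigma> = ?c \<circ> \<rho>" for \<rho>
    using image_by_trans[OF cL \<sigma>(2) c(1) \<sigma>(1)] by (simp only: that cc)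
  have t13: "image_by n id L L'" if "image_by n (transpose 1 3) L L'"
    by (rule involution[OF that c(2)]) (auto simp: fun_eq_iff transpose_def)
  have t23: "image_by n id L L'" if "image_by n (transpose 2 3) L L'"
    by (rule involution[OF that c(3)]) (auto simp: fun_eq_iff transpose_def)
  have "image_by n id L L'"
    using permutes_123_cases[OF \<sigma>(1)]
  proof (elim insertE emptyE)
    assume "\<sigma> = id" then show ?thesis using \<sigma>(2) by simp
  next
    assume "\<sigma> = ?c" then show ?thesis by (intro flip) simp
  next
    assume "\<sigma> = transpose 1 3" then show ?thesis using t13 \<sigma>(2) by simp
  next
    assume "\<sigma> = transpose 2 3" then show ?thesis using t23 \<sigma>(2) by simp
  next
    assume "\<sigma> = ?c \<circ> transpose 1 3" then show ?thesis by (intro t13 flip)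
  next
    assume "\<sigma> = ?c \<circ> transpose 2 3" then show ?thesis by (intro t23 flip)
  qed
  then show ?thesis
    using assms(1) unfolding isotopic_iff_image_by paratopic_def by blast
qed

lemma isotopic_subset_paratopic: "isotopic n \<subseteq> paratopic n"
proof (rule subrelI)
  fix L L' assume "(L, L') \<in> isotopic n"
  then have "latin_square n L" "latin_square n L'" "image_by n id L L'"
    unfolding isotopic_iff_image_by by auto
  then show "(L, L') \<in> paratopic n"
    unfolding paratopic_def image_by_def using permutes_id[of "{1, 2, 3}"] by blast
qed

lemma rrs_isotopic_subset_isotopic: "rrs_isotopic n \<subseteq> isotopic n"
  unfolding rrs_isotopic_def isotopic_def by blast

lemma card_species_eq_card_isotopism_classes:
  assumes "\<And>L. P L \<Longrightarrow> symmetric_ls L"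
  shows "card {C \<in> species n. \<exists>L\<in>C. P L} = card {C \<in> isotopism_classes n. \<exists>L\<in>C. P L}"
  unfolding species_def isotopism_classes_def
proof (rule card_classes_eq[OF equiv_paratopic equiv_isotopic, where f = id])
  fix L assume "L \<in> {L. latin_square n L}" "P L"
  then show "\<exists>K\<in>{L. latin_square n L}. P K \<and> (id K, L) \<in> isotopic n"
    using equiv_isotopic[of n] by (auto simp: equiv_def refl_on_def)
qed (use assms paratopic_symmetric_imp_isotopic isotopic_subset_paratopic[THEN subsetD] in auto)

section \<open>Fixed point free involutions\<close>

text \<open>The number of orbits is kept, not merely the parity of \<open>card A\<close>, so that a
  second involution can be applied to the orbits.\<close>

lemma card_eq_two_mul_card_orbits:
  assumes "finite A" "\<And>x. x \<in> A \<Longrightarrow> f x \<in> A" "\<And>x. x \<in> A \<Longrightarrow> f (f x) = x" "\<And>x. x \<in> A \<Longrightarrow> f x \<noteq> x"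
  shows "card A = 2 * card ((\<lambda>x. {x, f x}) ` A)"
proof -
  have "\<Union>((\<lambda>x. {x, f x}) ` A) = A"
    using assms(2) by auto
  moreover have "2 * card ((\<lambda>x. {x, f x}) ` A) = card (\<Union>((\<lambda>x. {x, f x}) ` A))"
  proof (rule card_partition)
    show "finite ((\<lambda>x. {x, f x}) ` A)" using assms(1) by blast
    show "finite (\<Union>((\<lambda>x. {x, f x}) ` A))" using assms(1) by auto
    show "card c = 2" if "c \<in> (\<lambda>x. {x, f x}) ` A" for c
      using that assms(4) by (auto simp: card_2_iff)
    show "c \<inter> d = {}" if "c \<in> (\<lambda>x. {x, f x}) ` A" "d \<in> (\<lambda>x. {x, f x}) ` A" "c \<noteq> d" for c d
      using that assms(3) by auto metis+
  qed
  ultimately show ?thesis by simp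
qed

lemma even_card_involution:
  assumes "finite A" "\<And>x. x \<in> A \<Longrightarrow> f x \<in> A" "\<And>x. x \<in> A \<Longrightarrow> f (f x) = x" "\<And>x. x \<in> A \<Longrightarrow> f x \<noteq> x"
  shows "even (card A)"
  using card_eq_two_mul_card_orbits[OF assms] by simp

text \<open>A free action of the Klein four-group. As \<open>g\<close> commutes with
  \<open>f\<close>, it permutes the \<open>f\<close>-orbits, and it fixes none because
  \<open>g x\<close> is neither \<open>x\<close> nor \<open>f x\<close>; so the number of orbits of
  size two is even.\<close>

lemma four_dvd_card_commuting_involutions:
  assumes A: "finite A"
    and f: "\<And>x. x \<in> A \<Longrightarrow> f x \<in> A" "\<And>x. x \<in> A \<Longrightarrow> f (f x) = x" "\<And>x. x \<in> A \<Longrightarrow> f x \<noteq> x"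
    and g: "\<And>x. x \<in> A \<Longrightarrow> g x \<in> A" "\<And>x. x \<in> A \<Longrightarrow> g (g x) = x" "\<And>x. x \<in> A \<Longrightarrow> g x \<noteq> x"
    and fg: "\<And>x. x \<in> A \<Longrightarrow> f (g x) = g (f x)" "\<And>x. x \<in> A \<Longrightarrow> f x \<noteq> g x"
  shows "4 dvd card A"
proof -
  let ?O = "(\<lambda>x. {x, f x}) ` A"
  have "even (card ?O)"
  proof (rule even_card_involution)
    show "finite ?O" using A by blast
    fix e assume "e \<in> ?O"
    then obtain x where x: "x \<in> A" "e = {x, f x}" by blast
    then have "g ` e = {g x, f (g x)}" using fg(1) by simp
    then show "g ` e \<in> ?O" using g(1) x(1) by blast
    show "g ` g ` e = e" using x f(1) g(2) by simp
    show "g ` e \<noteq> e" proof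
      assume "g ` e = e"
      then have "g x \<in> {x, f x}" using x(2) by blast
      then show False using g(3)[OF x(1)] fg(2)[OF x(1)] by simp
    qed
  qed
  then show ?thesis
    using card_eq_two_mul_card_orbits[OF A f] by auto
qed

lemma unipotent_lsD: "unipotent_ls L \<Longrightarrow> (i, i, s) \<in> L \<Longrightarrow> (j, j, t) \<in> L \<Longrightarrow> s = t"
  unfolding unipotent_ls_def by blast

section \<open>Relabelling symbols and reduced representatives\<close>

text \<open>If n cells contain all n symbols, reading them off is a permutation of the symbols, and
  its inverse is the required relabelling. The cells are arbitrary because both the first row and
  the main diagonal are used.\<close>

lemma relabel_cells:
  assumes L: "latin_square n L" and cells: "\<And>i. i \<in> {1..n} \<Longrightarrow> a i \<in> {1..n} \<and> b i \<in> {1..n}"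
    and all: "\<And>s. s \<in> {1..n} \<Longrightarrow> \<exists>i\<in>{1..n}. (a i, b i, s) \<in> L"
  obtains \<gamma> where "\<gamma> permutes {1..n}" "\<And>i. i \<in> {1..n} \<Longrightarrow> (a i, b i, i) \<in> isotopism id id \<gamma> ` L"
proof -
  \<comment> \<open>The value \<open>i\<close> outside \<open>{1..n}\<close> is what
    \<open>permutes\<close> demands.\<close>
  define f where "f i = (if i \<in> {1..n} then THE s. (a i, b i, s) \<in> L else i)" for i
  have f: "(a i, b i, f i) \<in> L" if "i \<in> {1..n}" for i
  proof -
    have "\<exists>!s. (a i, b i, s) \<in> L"
      using latin_square_symbol_exists[OF L, of "a i" "b i"] cells[OF that]
        latin_square_symbol_unique[OF L] by blast
    from theI'[OF this] show ?thesis unfolding f_def if_P[OF that] .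
  qed
  have p: "f permutes {1..n}"
  proof (rule bij_imp_permutes)
    have sub: "f ` {1..n} \<subseteq> {1..n}"
      using latin_square_bounds(3)[OF L f] by blast
    have "s \<in> f ` {1..n}" if "s \<in> {1..n}" for s
    proof -
      obtain i where i: "i \<in> {1..n}" "(a i, b i, s) \<in> L" using all \<open>s \<in> {1..n}\<close> by blast
      then have "s = f i" using latin_square_symbol_unique[OF L] f by blast
      then show ?thesis using i(1) by blast
    qed
    then have "f ` {1..n} = {1..n}" using sub by blast
    then show "bij_betw f {1..n} {1..n}"
      by (simp add: bij_betw_def eq_card_imp_inj_on)
  qed (simp only: f_def if_False)
  have inv: "inv f permutes {1..n}" by (rule permutes_inv[OF p])
  have "(id (a i), id (b i), inv f (f i)) \<in> isotopism id id (inv f) ` L" if "i \<in> {1..n}" for i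
    using mem_isotopism_image_iff[OF inj_on_id inj_on_id permutes_inj[OF inv]] f[OF that] by blast
  then have "(a i, b i, i) \<in> isotopism id id (inv f) ` L" if "i \<in> {1..n}" for i
    using that by (simp add: permutes_inverses[OF p])
  then show thesis using that inv by blast
qed

lemma relabel_to_reduced:
  assumes L: "latin_square n L" and sym: "symmetric_ls L" and n: "n > 0"
  obtains \<gamma> where "\<gamma> permutes {1..n}" "reduced_ls n (isotopism id id \<gamma> ` L)"
proof -
  have one: "1 \<in> {1..n}" using n by simp
  obtain \<gamma> where \<gamma>: "\<gamma> permutes {1..n}"
    "\<And>i. i \<in> {1..n} \<Longrightarrow> (1, i, i) \<in> isotopism id id \<gamma> ` L"
  proof (rule relabel_cells[OF L, of "\<lambda>i. 1" "\<lambda>i. i"])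
    show "\<exists>i\<in>{1..n}. (1, i, s) \<in> L" if "s \<in> {1..n}" for s
      using latin_square_column_exists[OF L one that] latin_square_bounds(2)[OF L] by blast
  qed (use one in blast)+
  then have "reduced_ls n (isotopism id id \<gamma> ` L)"
    unfolding reduced_ls_def using symmetric_lsD[OF symmetric_ls_isotopism[OF sym]] by blast
  then show thesis using that \<gamma>(1) by blast
qed

lemma rrs_isotopic_reduced:
  assumes "latin_square n L" "symmetric_ls L" "unipotent_ls L" "n > 0"
  obtains K where "(L, K) \<in> rrs_isotopic n" "symmetric_ls K" "unipotent_ls K" "reduced_ls n K"
proof -
  obtain \<gamma> where \<gamma>: "\<gamma> permutes {1..n}" "reduced_ls n (isotopism id id \<gamma> ` L)"
    using relabel_to_reduced assms by blast
  have "(L, isotopism id id \<gamma> ` L) \<in> rrs_isotopic n"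
    unfolding rrs_isotopic_def
    using assms(1) latin_square_isotopism[OF assms(1) permutes_id permutes_id \<gamma>(1)] \<gamma>(1) permutes_id
    by blast
  then show thesis
    using that \<gamma>(2) symmetric_ls_isotopism[OF assms(2)] unipotent_ls_isotopism[OF assms(3) inj_on_id]
    by blast
qed

text \<open>Relabelling symbols is an rrs-isotopism, and rrs-isotopism is the finest of the three
  relations in (viii), so one argument covers them all.\<close>

lemma class_contains_reduced:
  assumes r: "equiv {L. latin_square n L} r" and sub: "rrs_isotopic n \<subseteq> r" and n: "n > 0"
    and C: "C \<in> {L. latin_square n L} // r" "\<exists>L\<in>C. symmetric_ls L \<and> unipotent_ls L"
  shows "\<exists>L\<in>C. symmetric_ls L \<and> unipotent_ls L \<and> reduced_ls n L"
proof -
  obtain L where L: "L \<in> C" "symmetric_ls L" "unipotent_ls L" using C(2) by blast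
  then have "latin_square n L" using in_quotient_imp_subset[OF r C(1)] by blast
  then obtain K where K: "(L, K) \<in> rrs_isotopic n" "symmetric_ls K" "unipotent_ls K" "reduced_ls n K"
    using rrs_isotopic_reduced L n by blast
  then have "K \<in> C" using in_quotient_imp_closed[OF r C(1) L(1)] sub by blast
  then show ?thesis using K by blast
qed

section \<open>Isotopic and rrs-isotopic squares for n congruent to 2 modulo 4\<close>

lemma reduced_unipotent_diagonal:
  assumes "latin_square n L" "reduced_ls n L" "unipotent_ls L" "n > 0"
  shows "(i, i, s) \<in> L \<longleftrightarrow> i \<in> {1..n} \<and> s = 1"
proof -
  have "(1, 1, 1) \<in> L" using assms(2,4) unfolding reduced_ls_def by simp
  then show ?thesis
    using unipotent_lsD[OF assms(3)] latin_square_bounds(1)[OF assms(1), of i i s]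
      latin_square_symbol_exists[OF assms(1), of i i] by metis
qed

text \<open>If the row and column permutations differ by \<open>\<theta> \<noteq> id\<close>, then \<open>\<theta>\<close> is the fixed point free
  involution given by an off-diagonal symbol of \<open>L\<close> and commutes with the involution of every
  other off-diagonal symbol. Two such involutions generate a group acting freely, so that \<open>4\<close>
  divides \<open>n\<close>; a second off-diagonal symbol exists unless \<open>n = 2\<close>.\<close>

lemma isotopic_imp_rrs_isotopic:
  assumes LL': "(L, L') \<in> isotopic n" and sym: "symmetric_ls L" "symmetric_ls L'"
    and uni: "unipotent_ls L" "unipotent_ls L'" and n: "n mod 4 = 2" "n > 2"
  shows "(L, L') \<in> rrs_isotopic n"
proof -
  have L: "latin_square n L" and L': "latin_square n L'"
    using LL' unfolding isotopic_def by auto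
  obtain \<alpha> \<beta> \<gamma> where p: "\<alpha> permutes {1..n}" "\<beta> permutes {1..n}" "\<gamma> permutes {1..n}"
    and eq: "L' = isotopism \<alpha> \<beta> \<gamma> ` L"
    using LL' unfolding isotopic_def by blast
  note mem = mem_isotopism_image_iff[OF permutes_inj[OF p(1)] permutes_inj[OF p(2)]
      permutes_inj[OF p(3)], of _ _ _ L, folded eq]
  define \<theta> where "\<theta> = inv \<beta> \<circ> \<alpha>"
  have \<theta>: "\<theta> permutes {1..n}"
    unfolding \<theta>_def by (rule permutes_compose[OF p(1) permutes_inv[OF p(2)]])
  have \<beta>\<theta>: "\<beta> (\<theta> i) = \<alpha> i" for i
    by (simp add: \<theta>_def permutes_inverses[OF p(2)])
  \<comment> \<open>Cell \<open>(i, \<theta> j)\<close> of \<open>L\<close> is carried to cell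
    \<open>(\<alpha> i, \<alpha> j)\<close> of \<open>L'\<close>, so this is the symmetry of
    \<open>L'\<close> seen inside \<open>L\<close>.\<close>
  have swap: "(i, \<theta> j, s) \<in> L \<longleftrightarrow> (j, \<theta> i, s) \<in> L" for i j s
    using symmetric_lsD[OF sym(2)] mem[of i "\<theta> j" s] mem[of j "\<theta> i" s] by (auto simp: \<beta>\<theta>)
  have one: "1 \<in> {1..n}" using n by simp
  have in\<theta>: "\<theta> i \<in> {1..n}" if "i \<in> {1..n}" for i
    using that unfolding permutes_in_image[OF \<theta>] .
  \<comment> \<open>The cells \<open>(i, \<theta> i)\<close> are the preimage of the diagonal of
    \<open>L'\<close>; as \<open>L'\<close> is unipotent, they share one symbol
    \<open>e\<close>.\<close>
  obtain e where e1: "(1, \<theta> 1, e) \<in> L"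
    using latin_square_symbol_exists[OF L one in\<theta>[OF one]] by blast
  have e: "(i, \<theta> i, e) \<in> L" if i: "i \<in> {1..n}" for i
  proof -
    obtain t where t: "(i, \<theta> i, t) \<in> L"
      using latin_square_symbol_exists[OF L i in\<theta>[OF i]] by blast
    have "(\<alpha> 1, \<alpha> 1, \<gamma> e) \<in> L'" "(\<alpha> i, \<alpha> i, \<gamma> t) \<in> L'"
      using mem[of 1 "\<theta> 1" e] mem[of i "\<theta> i" t] e1 t by (auto simp: \<beta>\<theta>)
    then have "\<gamma> e = \<gamma> t" by (rule unipotent_lsD[OF uni(2)])
    then show ?thesis using t permutes_inj[OF p(3)] by (simp add: inj_eq)
  qed
  obtain d where d1: "(1, 1, d) \<in> L"
    using latin_square_symbol_exists[OF L one one] by blast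
  have d: "(i, i, d) \<in> L" if "i \<in> {1..n}" for i
    using latin_square_symbol_exists[OF L that that] unipotent_lsD[OF uni(1) d1] by metis
  show ?thesis
  proof (cases "e = d")
    case True
    have "\<theta> i = i" for i
    proof (cases "i \<in> {1..n}")
      case i: True
      show ?thesis using e[OF i] d[OF i] True latin_square_column_unique[OF L] by blast
    next
      case False
      then show ?thesis by (rule permutes_not_in[OF \<theta>])
    qed
    then have "\<alpha> = \<beta>" using \<beta>\<theta> by (simp add: fun_eq_iff)
    then show ?thesis using p eq L L' unfolding rrs_isotopic_def by blast
  next
    case False
    have \<theta>\<theta>: "\<theta> (\<theta> i) = i" if "i \<in> {1..n}" for i
      using latin_square_column_unique[OF L symmetric_lsD[OF sym(1) e[OF that]] e[OF in\<theta>[OF that]]]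
      by simp
    have \<theta>_ne: "\<theta> i \<noteq> i" if "i \<in> {1..n}" for i
      using e[OF that] d[OF that] False latin_square_symbol_unique[OF L] by metis
    have "card {d, e} < card {1..n}"
      using n card_insert_le_m1[of 2 "{e}" d] by simp
    then have "\<not> {1..n} \<subseteq> {d, e}"
      using card_mono[of "{d, e}" "{1..n}"] by auto
    then obtain b where b: "b \<in> {1..n}" "b \<noteq> d" "b \<noteq> e" by blast
    define h where "h i = (THE j. (i, j, b) \<in> L)" for i
    have h: "(i, h i, b) \<in> L" if "i \<in> {1..n}" for i
      unfolding h_def
      by (rule theI') (use latin_square_column_exists[OF L that b(1)] latin_square_column_unique[OF L]
          in blast)
    have h_eq: "h i = j" if "(i, j, b) \<in> L" for i j
      using latin_square_column_unique[OF L that h] latin_square_bounds(1)[OF L that] by simp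
    have "4 dvd card {1..n}"
    proof (rule four_dvd_card_commuting_involutions)
      fix i assume i: "i \<in> {1..n}"
      show "\<theta> i \<in> {1..n}" "\<theta> (\<theta> i) = i" "\<theta> i \<noteq> i" using i in\<theta> \<theta>\<theta> \<theta>_ne by auto
      show "h i \<in> {1..n}" using latin_square_bounds(2)[OF L h[OF i]] .
      show "h (h i) = i" by (rule h_eq[OF symmetric_lsD[OF sym(1) h[OF i]]])
      show "h i \<noteq> i" using h[OF i] d[OF i] b(2) latin_square_symbol_unique[OF L] by metis
      show "\<theta> i \<noteq> h i" using h[OF i] e[OF i] b(3) latin_square_symbol_unique[OF L] by metis
      \<comment> \<open>Writing \<open>h i\<close> as \<open>\<theta> (\<theta> (h i))\<close> gives
        the triple the shape on which \<open>swap\<close> acts; the result says that \<theta>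
        commutes with \<open>h\<close>.\<close>
      have "(i, \<theta> (\<theta> (h i)), b) \<in> L"
        using h[OF i] \<theta>\<theta>[OF \<open>h i \<in> {1..n}\<close>] by simp
      then have "(\<theta> (h i), \<theta> i, b) \<in> L" unfolding swap .
      then have "(\<theta> i, \<theta> (h i), b) \<in> L" by (rule symmetric_lsD[OF sym(1)])
      then show "\<theta> (h i) = h (\<theta> i)" using h_eq by simp
    qed simp
    then have False using n by (simp add: mod_eq_0_iff_dvd[symmetric])
    then show ?thesis ..
  qed
qed

text \<open>Covers n = 2, where there is no third symbol to produce a second involution. Every
  off-diagonal cell lies in the first row or column, so reducedness and the constant diagonal
  determine the square.\<close>

lemma reduced_unipotent_order_2:
  assumes "latin_square 2 L" "reduced_ls 2 L" "unipotent_ls L"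
  shows "L = {(1, 1, 1), (2, 2, 1), (1, 2, 2), (2, 1, 2)}"
proof -
  have diag: "(i, i, s) \<in> L \<longleftrightarrow> i \<in> {1..2} \<and> s = 1" for i s
    by (rule reduced_unipotent_diagonal[OF assms]) simp
  have "(1, 2, 2) \<in> L" "(2, 1, 2) \<in> L"
    using assms(2) unfolding reduced_ls_def by auto
  then have off: "(1, 2, s) \<in> L \<longleftrightarrow> s = 2" "(2, 1, s) \<in> L \<longleftrightarrow> s = 2" for s
    using latin_square_symbol_unique[OF assms(1)] by blast+
  have "(i, j, s) \<in> L \<longleftrightarrow> (i, j, s) \<in> {(1, 1, 1), (2, 2, 1), (1, 2, 2), (2, 1, 2)}" for i j s
  proof (cases "i \<in> {1..2} \<and> j \<in> {1..2}")
    case True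
    then have "(i = 1 \<or> i = 2) \<and> (j = 1 \<or> j = 2)" by auto
    then show ?thesis using diag[of 1 s] diag[of 2 s] off[of s] by auto
  next
    case False
    then show ?thesis using latin_square_bounds[OF assms(1), of i j s] by auto
  qed
  then show ?thesis by auto
qed

lemma isotopic_imp_rrs_isotopic_mod_4:
  assumes LL': "(L, L') \<in> isotopic n" and sym: "symmetric_ls L" "symmetric_ls L'"
    and uni: "unipotent_ls L" "unipotent_ls L'" and n: "n mod 4 = 2"
  shows "(L, L') \<in> rrs_isotopic n"
proof (cases "n = 2")
  case False
  then have "n > 2" using n by presburger
  then show ?thesis using isotopic_imp_rrs_isotopic assms by blast
next
  case True
  have L: "latin_square n L" and L': "latin_square n L'"
    using LL' unfolding isotopic_def by auto
  have n0: "n > 0" using True by simp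
  obtain K where K: "(L, K) \<in> rrs_isotopic n" "unipotent_ls K" "reduced_ls n K"
    using rrs_isotopic_reduced[OF L sym(1) uni(1) n0] by blast
  obtain K' where K': "(L', K') \<in> rrs_isotopic n" "unipotent_ls K'" "reduced_ls n K'"
    using rrs_isotopic_reduced[OF L' sym(2) uni(2) n0] by blast
  have "latin_square n K" "latin_square n K'"
    using K(1) K'(1) unfolding rrs_isotopic_def by auto
  then have "K = K'"
    using reduced_unipotent_order_2[of K] reduced_unipotent_order_2[of K'] K(2,3) K'(2,3)
    unfolding True by argo
  then show ?thesis
    using K(1) K'(1) equiv_rrs_isotopic[of n] by (meson equivE symE transE)
qed

lemma card_isotopism_classes_eq_card_rrs_isotopism_classes:
  assumes "n mod 4 = 2"
  shows "card {C \<in> isotopism_classes n. \<exists>L\<in>C. symmetric_ls L \<and> unipotent_ls L}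
    = card {C \<in> rrs_isotopism_classes n. \<exists>L\<in>C. symmetric_ls L \<and> unipotent_ls L}"
  unfolding rrs_isotopism_classes_def isotopism_classes_def
proof (rule card_classes_eq[OF equiv_isotopic equiv_rrs_isotopic, where f = id])
  fix L assume "L \<in> {L. latin_square n L}" "symmetric_ls L \<and> unipotent_ls L"
  then show "\<exists>K\<in>{L. latin_square n L}. (symmetric_ls K \<and> unipotent_ls K) \<and> (id K, L) \<in> rrs_isotopic n"
    using equiv_rrs_isotopic[of n] by (auto simp: equiv_def refl_on_def)
qed (use assms isotopic_imp_rrs_isotopic_mod_4 rrs_isotopic_subset_isotopic[THEN subsetD] in auto)

section \<open>Relabelling and prolongation\<close>

text \<open>Relabelling a normalised square by \<gamma> puts \<gamma> i into the i-th chosen cell.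
  The chosen cells thus spell out \<gamma>, and the pair of \<gamma> and the normalised square can
  be recovered from the result.\<close>

lemma card_eq_fact_mult_card_normalised:
  assumes X: "\<And>L. L \<in> X \<Longrightarrow> latin_square n L"
    and closed: "\<And>L \<gamma>. L \<in> X \<Longrightarrow> \<gamma> permutes {1..n} \<Longrightarrow> isotopism id id \<gamma> ` L \<in> X"
    and cells: "\<And>i. i \<in> {1..n} \<Longrightarrow> a i \<in> {1..n} \<and> b i \<in> {1..n}"
    and all: "\<And>L s. L \<in> X \<Longrightarrow> s \<in> {1..n} \<Longrightarrow> \<exists>i\<in>{1..n}. (a i, b i, s) \<in> L"
  shows "card X = fact n * card {L \<in> X. \<forall>i\<in>{1..n}. (a i, b i, i) \<in> L}"
proof -
  let ?S = "{\<gamma>. \<gamma> permutes {1..n}}" and ?N = "{L \<in> X. \<forall>i\<in>{1..n}. (a i, b i, i) \<in> L}"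
  let ?r = "\<lambda>(\<gamma>, L). isotopism id id \<gamma> ` L"
  have mem: "(i, j, \<gamma> s) \<in> isotopism id id \<gamma> ` L \<longleftrightarrow> (i, j, s) \<in> L" if "\<gamma> permutes {1..n}"
    for \<gamma> i j s L
    using mem_isotopism_image_iff[OF inj_on_id inj_on_id permutes_inj[OF that], of i j s L] by simp
  have "bij_betw ?r (?S \<times> ?N) X"
  proof (rule bij_betw_imageI)
    show "inj_on ?r (?S \<times> ?N)"
    proof (rule inj_onI, clarify)
      fix \<gamma> L \<gamma>' L'
      assume \<gamma>: "\<gamma> permutes {1..n}" and L: "L \<in> X" "\<forall>i\<in>{1..n}. (a i, b i, i) \<in> L"
        and \<gamma>': "\<gamma>' permutes {1..n}" and L': "L' \<in> X" "\<forall>i\<in>{1..n}. (a i, b i, i) \<in> L'"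
        and eq: "isotopism id id \<gamma> ` L = isotopism id id \<gamma>' ` L'"
      have "\<gamma> i = \<gamma>' i" for i
      proof (cases "i \<in> {1..n}")
        case True
        have "(a i, b i, \<gamma> i) \<in> isotopism id id \<gamma> ` L"
          using mem[OF \<gamma>] L(2) True by blast
        moreover have "(a i, b i, \<gamma>' i) \<in> isotopism id id \<gamma> ` L"
          unfolding eq using mem[OF \<gamma>'] L'(2) True by blast
        ultimately show ?thesis
          by (rule latin_square_symbol_unique[OF X[OF closed[OF L(1) \<gamma>]]])
      next
        case False
        then show ?thesis
          using permutes_not_in[OF \<gamma> False] permutes_not_in[OF \<gamma>' False] by simp
      qed
      then have "\<gamma> = \<gamma>'" by blast
      moreover have "(i, j, s) \<in> L \<longleftrightarrow> (i, j, s) \<in> L'" for i j s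
        using mem[OF \<gamma>, of i j s L] mem[OF \<gamma>', of i j s L'] eq \<open>\<gamma> = \<gamma>'\<close> by simp
      ultimately show "\<gamma> = \<gamma>' \<and> L = L'" by auto
    qed
    show "?r ` (?S \<times> ?N) = X"
    proof (intro equalityI subsetI)
      fix L assume L: "L \<in> X"
      obtain \<gamma> where \<gamma>: "\<gamma> permutes {1..n}"
        "\<And>i. i \<in> {1..n} \<Longrightarrow> (a i, b i, i) \<in> isotopism id id \<gamma> ` L"
        using relabel_cells[OF X[OF L] cells all[OF L]] by blast
      have "?r (inv \<gamma>, isotopism id id \<gamma> ` L) = L"
        by (simp only: prod.case isotopism_image_compose permutes_inv_o[OF \<gamma>(1)] o_id isotopism_id_image)
      moreover have "(inv \<gamma>, isotopism id id \<gamma> ` L) \<in> ?S \<times> ?N"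
        using permutes_inv[OF \<gamma>(1)] closed[OF L \<gamma>(1)] \<gamma>(2) by blast
      ultimately show "L \<in> ?r ` (?S \<times> ?N)" by (metis (no_types, lifting) imageI)
    next
      fix K assume "K \<in> ?r ` (?S \<times> ?N)"
      then show "K \<in> X" using closed by auto
    qed
  qed
  then have "card X = card (?S \<times> ?N)" by (simp add: bij_betw_same_card)
  also have "\<dots> = fact n * card ?N"
    by (simp add: card_cartesian_product card_permutations)
  finally show ?thesis .
qed

section \<open>Diagonals of symmetric squares of odd order\<close>

lemma odd_symmetric_diagonal_exists:
  assumes L: "latin_square m L" and sym: "symmetric_ls L" and m: "odd m" and s: "s \<in> {1..m}"
  shows "\<exists>i\<in>{1..m}. (i, i, s) \<in> L"
proof (rule ccontr)
  assume no: "\<not> (\<exists>i\<in>{1..m}. (i, i, s) \<in> L)"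
  define h where "h i = (THE j. (i, j, s) \<in> L)" for i
  have h: "(i, h i, s) \<in> L" if "i \<in> {1..m}" for i
    unfolding h_def
    by (rule theI') (use latin_square_column_exists[OF L that s] latin_square_column_unique[OF L]
        in blast)
  have "even (card {1..m})"
  proof (rule even_card_involution)
    fix i assume i: "i \<in> {1..m}"
    show hi: "h i \<in> {1..m}" using latin_square_bounds(2)[OF L h[OF i]] .
    show "h (h i) = i"
      using latin_square_column_unique[OF L symmetric_lsD[OF sym h[OF i]] h[OF hi]] by simp
    show "h i \<noteq> i" using h[OF i] no i by metis
  qed simp
  then show False using m by simp
qed

text \<open>There are as many diagonal cells as symbols, so a diagonal that contains every symbol
  repeats none. Prolongation needs this because the diagonal becomes a row.\<close>

lemma odd_symmetric_diagonal_unique: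
  assumes L: "latin_square m L" and sym: "symmetric_ls L" and m: "odd m"
    and i: "(i, i, s) \<in> L" and j: "(j, j, s) \<in> L"
  shows "i = j"
proof -
  define f where "f i = (THE s. (i, i, s) \<in> L)" for i
  have f_eq: "f i = s" if "(i, i, s) \<in> L" for i s
    unfolding f_def by (rule the_equality) (use that latin_square_symbol_unique[OF L] in blast)+
  have f: "(i, i, f i) \<in> L" if "i \<in> {1..m}" for i
    using latin_square_symbol_exists[OF L that that] f_eq by blast
  have "s \<in> f ` {1..m}" if "s \<in> {1..m}" for s
    using odd_symmetric_diagonal_exists[OF L sym m that] f_eq by blast
  moreover have "f ` {1..m} \<subseteq> {1..m}"
    using latin_square_bounds(3)[OF L f] by blast
  ultimately have "f ` {1..m} = {1..m}" by blast
  then have "inj_on f {1..m}"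
    by (simp add: eq_card_imp_inj_on)
  then show ?thesis
    by (rule inj_onD[OF _ _ latin_square_bounds(1)[OF L i] latin_square_bounds(1)[OF L j]])
      (simp only: f_eq[OF i] f_eq[OF j])
qed

section \<open>Prolongation and contraction\<close>

text \<open>Only the diagonal clause states bounds: every other entry is copied from a triple of
  \<open>L\<close> and inherits its bounds from there.\<close>

definition prolong :: "nat \<Rightarrow> triple set \<Rightarrow> triple set" where
  "prolong m L = {(i, j, s).
     if i = j then i \<in> {1..Suc m} \<and> s = Suc m
     else if i = Suc m then (j, j, s) \<in> L
     else if j = Suc m then (i, i, s) \<in> L
     else (i, j, s) \<in> L}"

definition contract :: "nat \<Rightarrow> triple set \<Rightarrow> triple set" where
  "contract m K = {(i, j, s). i \<in> {1..m} \<and> j \<in> {1..m} \<and>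
     (if i = j then (i, Suc m, s) \<in> K else (i, j, s) \<in> K)}"

lemma mem_prolong:
  "(i, j, s) \<in> prolong m L \<longleftrightarrow>
    (if i = j then i \<in> {1..Suc m} \<and> s = Suc m
     else if i = Suc m then (j, j, s) \<in> L
     else if j = Suc m then (i, i, s) \<in> L
     else (i, j, s) \<in> L)"
  by (simp add: prolong_def)

lemma mem_contract:
  "(i, j, s) \<in> contract m K \<longleftrightarrow> i \<in> {1..m} \<and> j \<in> {1..m} \<and>
     (if i = j then (i, Suc m, s) \<in> K else (i, j, s) \<in> K)"
  by (simp add: contract_def)

lemma symmetric_ls_prolong: "symmetric_ls L \<Longrightarrow> symmetric_ls (prolong m L)"
  unfolding symmetric_ls_iff mem_prolong by (auto split: if_splits)

lemma unipotent_ls_prolong: "unipotent_ls (prolong m L)"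
  unfolding unipotent_ls_def mem_prolong by simp

text \<open>An old row keeps its symbols, since its diagonal entry only moves to the last column,
  and gains \<open>Suc m\<close>. The new row is the old diagonal, and distinctness of its entries
  is where odd order enters. Columns follow by symmetry.\<close>

lemma latin_square_prolong:
  assumes L: "latin_square m L" and sym: "symmetric_ls L" and m: "odd m"
  shows "latin_square (Suc m) (prolong m L)"
proof -
  have bnd: "i \<noteq> Suc m \<and> j \<noteq> Suc m \<and> s \<noteq> Suc m \<and> i \<in> {1..Suc m} \<and> j \<in> {1..Suc m} \<and> s \<in> {1..Suc m}"
    if "(i, j, s) \<in> L" for i j s
    using latin_square_bounds[OF L that] by auto
  have col: "j = j'" if "(i, j, s) \<in> prolong m L" "(i, j', s) \<in> prolong m L" for i j j' s
  proof -
    consider "s = Suc m" | "s \<noteq> Suc m" "i = Suc m" | "s \<noteq> Suc m" "i \<noteq> Suc m" by blast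
    then show ?thesis
    proof cases
      case 1
      have "k = i" if "(i, k, Suc m) \<in> prolong m L" for k
        using that bnd[of k k "Suc m"] bnd[of i i "Suc m"] bnd[of i k "Suc m"]
        by (auto simp: mem_prolong split: if_splits)
      from this[of j] this[of j'] show ?thesis using that 1 by simp
    next
      case 2
      then show ?thesis
        using that odd_symmetric_diagonal_unique[OF L sym m, of j s j'] unfolding mem_prolong
        by (simp split: if_splits)
    next
      case 3
      \<comment> \<open>Undoing the move sends column \<open>Suc m\<close> back to column
        \<open>i\<close>. No two columns are merged by this, because neither column in question is
        \<open>i\<close> itself.\<close>
      have key: "(i, if k = Suc m then i else k, s) \<in> L" "i \<noteq> k" if "(i, k, s) \<in> prolong m L" for k
        using that 3 by (auto simp: mem_prolong split: if_splits)
      have "(if j = Suc m then i else j) = (if j' = Suc m then i else j')"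
        by (rule latin_square_column_unique[OF L key(1)[OF that(1)] key(1)[OF that(2)]])
      then show ?thesis using key(2)[OF that(1)] key(2)[OF that(2)] by argo
    qed
  qed
  show ?thesis
    unfolding latin_square_iff
  proof (intro conjI allI ballI impI)
    fix i j s assume p: "(i, j, s) \<in> prolong m L"
    have "i \<in> {1..Suc m} \<and> j \<in> {1..Suc m} \<and> s \<in> {1..Suc m}"
    proof (cases "i = j")
      case True
      then show ?thesis using p by (simp add: mem_prolong)
    next
      case False
      then consider "i = Suc m" "(j, j, s) \<in> L" | "j = Suc m" "(i, i, s) \<in> L" | "(i, j, s) \<in> L"
        using p by (auto simp: mem_prolong split: if_splits)
      then show ?thesis by cases (use bnd in auto)
    qed
    then show "i \<in> {1..Suc m}" "j \<in> {1..Suc m}" "s \<in> {1..Suc m}" by blast+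
  next
    fix i j s s' assume "(i, j, s) \<in> prolong m L" "(i, j, s') \<in> prolong m L"
    then show "s = s'"
      unfolding mem_prolong using latin_square_symbol_unique[OF L, of _ _ s s']
      by (cases "i = j"; cases "i = Suc m"; cases "j = Suc m"; simp)
  next
    fix i j j' s assume "(i, j, s) \<in> prolong m L" "(i, j', s) \<in> prolong m L"
    then show "j = j'" by (rule col)
  next
    fix i i' j s assume "(i, j, s) \<in> prolong m L" "(i', j, s) \<in> prolong m L"
    then show "i = i'"
      using col symmetric_lsD[OF symmetric_ls_prolong[OF sym]] by blast
  next
    fix i j assume ij: "i \<in> {1..Suc m}" "j \<in> {1..Suc m}"
    have in_m: "k \<in> {1..m}" if "k \<in> {1..Suc m}" "k \<noteq> Suc m" for k using that by auto
    show "\<exists>s. (i, j, s) \<in> prolong m L"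
      unfolding mem_prolong
      using latin_square_symbol_exists[OF L] in_m[OF ij(1)] in_m[OF ij(2)] ij
      by (cases "i = j"; cases "i = Suc m"; cases "j = Suc m"; simp)
  qed
qed

lemma contract_prolong:
  assumes "latin_square m L"
  shows "contract m (prolong m L) = L"
proof -
  have "(i, j, s) \<in> contract m (prolong m L) \<longleftrightarrow> (i, j, s) \<in> L" for i j s
    using latin_square_bounds[OF assms, of i j s] unfolding mem_contract mem_prolong by auto
  then show ?thesis by auto
qed

text \<open>The symbol \<open>Suc m\<close> fills the diagonal, so it occurs nowhere else. Deleting
  the last line therefore leaves only smaller symbols off the diagonal, and the symbol that row
  \<open>i\<close> loses from the last column is put back at \<open>(i, i)\<close>.\<close>

lemma prolong_contract:
  assumes K: "latin_square (Suc m) K" and sym: "symmetric_ls K" and uni: "unipotent_ls K"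
    and diag: "(1, 1, Suc m) \<in> K"
  shows "latin_square m (contract m K)" "symmetric_ls (contract m K)"
    "prolong m (contract m K) = K"
proof -
  have K_diag: "(i, i, s) \<in> K \<longleftrightarrow> i \<in> {1..Suc m} \<and> s = Suc m" for i s
    using unipotent_lsD[OF uni diag, of i s] latin_square_bounds(1)[OF K, of i i s]
      latin_square_symbol_exists[OF K, of i i] unipotent_lsD[OF uni diag, of i] by metis
  have flip: "(i, j, s) \<in> K \<longleftrightarrow> (j, i, s) \<in> K" for i j s
    using symmetric_lsD[OF sym] by blast
  have off: "s \<in> {1..m}" if "(i, j, s) \<in> K" "i \<noteq> j" for i j s
  proof -
    have "s \<noteq> Suc m"
      using that K_diag[of i s] latin_square_bounds(1)[OF K that(1)] latin_square_column_unique[OF K]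
      by metis
    then show ?thesis using latin_square_bounds(3)[OF K that(1)] by auto
  qed
  have mem: "(i, j, s) \<in> contract m K \<longleftrightarrow> i \<in> {1..m} \<and> j \<in> {1..m} \<and> (i, if i = j then Suc m else j, s) \<in> K"
    for i j s unfolding mem_contract by simp
  show sym': "symmetric_ls (contract m K)"
    unfolding symmetric_ls_iff mem_contract using flip by (simp split: if_splits)
  have col: "j = j'" if "(i, j, s) \<in> contract m K" "(i, j', s) \<in> contract m K" for i j j' s
  proof -
    have "(if i = j then Suc m else j) = (if i = j' then Suc m else j')"
      using that latin_square_column_unique[OF K] unfolding mem by blast
    moreover have "j \<noteq> Suc m" "j' \<noteq> Suc m" using that unfolding mem by auto
    ultimately show ?thesis by (simp split: if_splits)
  qed
  show "latin_square m (contract m K)"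
    unfolding latin_square_iff
  proof (intro conjI allI ballI impI)
    fix i j s assume *: "(i, j, s) \<in> contract m K"
    then show "i \<in> {1..m}" "j \<in> {1..m}" unfolding mem by auto
    from * have "(i, if i = j then Suc m else j, s) \<in> K" "i \<noteq> (if i = j then Suc m else j)"
      unfolding mem by auto
    then show "s \<in> {1..m}" by (rule off)
  next
    fix i j s s' assume "(i, j, s) \<in> contract m K" "(i, j, s') \<in> contract m K"
    then show "s = s'" unfolding mem using latin_square_symbol_unique[OF K] by blast
  next
    fix i j j' s assume "(i, j, s) \<in> contract m K" "(i, j', s) \<in> contract m K"
    then show "j = j'" by (rule col)
  next
    fix i i' j s assume "(i, j, s) \<in> contract m K" "(i', j, s) \<in> contract m K"
    then show "i = i'" using col symmetric_lsD[OF sym'] by blast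
  next
    fix i j assume ij: "i \<in> {1..m}" "j \<in> {1..m}"
    then have "i \<in> {1..Suc m}" "(if i = j then Suc m else j) \<in> {1..Suc m}" by auto
    from latin_square_symbol_exists[OF K this]
    show "\<exists>s. (i, j, s) \<in> contract m K" unfolding mem using ij by blast
  qed
  have "(i, j, s) \<in> prolong m (contract m K) \<longleftrightarrow> (i, j, s) \<in> K" for i j s
  proof (cases "i \<in> {1..Suc m} \<and> j \<in> {1..Suc m}")
    case True
    then show ?thesis
      using K_diag[of i s] flip[of j "Suc m" s] unfolding mem_prolong mem by auto
  next
    case False
    then have "(i, j, s) \<notin> K" using latin_square_bounds[OF K] by blast
    moreover have "(i, j, s) \<notin> prolong m (contract m K)"
      using False unfolding mem_prolong mem by auto
    ultimately show ?thesis by blast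
  qed
  then show "prolong m (contract m K) = K" by auto
qed

text \<open>A permutation of \<open>{1..m}\<close> fixes \<open>Suc m\<close>, so each case
  distinction of \<open>mem_prolong\<close> is invariant under its inverse.\<close>

lemma prolong_isotopism:
  assumes \<alpha>: "\<alpha> permutes {1..m}"
  shows "prolong m (isotopism \<alpha> \<alpha> \<alpha> ` L) = isotopism \<alpha> \<alpha> \<alpha> ` prolong m L"
proof -
  have \<alpha>': "\<alpha> permutes {1..Suc m}"
    by (rule permutes_subset[OF \<alpha>]) simp
  have last: "inv \<alpha> (Suc m) = Suc m"
    by (rule permutes_not_in[OF permutes_inv[OF \<alpha>]]) simp
  have inj: "inv \<alpha> x = inv \<alpha> y \<longleftrightarrow> x = y" for x y
    using permutes_inj[OF permutes_inv[OF \<alpha>]] by (simp add: inj_eq)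
  have N: "inv \<alpha> x = Suc m \<longleftrightarrow> x = Suc m" for x
    using inj[of x "Suc m"] last by simp
  have "(i, j, s) \<in> prolong m (isotopism \<alpha> \<alpha> \<alpha> ` L) \<longleftrightarrow> (i, j, s) \<in> isotopism \<alpha> \<alpha> \<alpha> ` prolong m L"
    for i j s
    unfolding mem_prolong mem_isotopism_image[OF \<alpha> \<alpha> \<alpha>] N inj
      permutes_in_image[OF permutes_inv[OF \<alpha>']] ..
  then show ?thesis by auto
qed

section \<open>Isomorphism classes under prolongation\<close>

lemma card_isomorphism_classes_prolong:
  assumes m: "odd m"
  shows "card {C \<in> isomorphism_classes m. \<exists>L\<in>C. symmetric_ls L}
    = card {C \<in> isomorphism_classes (Suc m). \<exists>L\<in>C. symmetric_ls L \<and> unipotent_ls L}"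
  unfolding isomorphism_classes_def
proof (rule card_classes_eq[OF equiv_isomorphic equiv_isomorphic, where f = "prolong m"])
  fix L assume "L \<in> {L. latin_square m L}" "symmetric_ls L"
  then show "prolong m L \<in> {L. latin_square (Suc m) L} \<and>
      symmetric_ls (prolong m L) \<and> unipotent_ls (prolong m L)"
    using latin_square_prolong m symmetric_ls_prolong unipotent_ls_prolong by blast
next
  fix L L' assume "L \<in> {L. latin_square m L}" "L' \<in> {L. latin_square m L}" and sym: "symmetric_ls L" "symmetric_ls L'"
  then have L: "latin_square m L" and L': "latin_square m L'" by auto
  have P: "latin_square (Suc m) (prolong m L)" "latin_square (Suc m) (prolong m L')"
    using latin_square_prolong m L L' sym by auto
  show "(L, L') \<in> isomorphic m \<longleftrightarrow> (prolong m L, prolong m L') \<in> isomorphic (Suc m)"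
  proof
    assume "(L, L') \<in> isomorphic m"
    then obtain \<alpha> where \<alpha>: "\<alpha> permutes {1..m}" "L' = isotopism \<alpha> \<alpha> \<alpha> ` L"
      unfolding isomorphic_def by blast
    moreover have "\<alpha> permutes {1..Suc m}" by (rule permutes_subset[OF \<alpha>(1)]) simp
    ultimately show "(prolong m L, prolong m L') \<in> isomorphic (Suc m)"
      unfolding isomorphic_def using P prolong_isotopism[OF \<alpha>(1)] by blast
  next
    assume "(prolong m L, prolong m L') \<in> isomorphic (Suc m)"
    then obtain \<alpha> where \<alpha>: "\<alpha> permutes {1..Suc m}" "prolong m L' = isotopism \<alpha> \<alpha> \<alpha> ` prolong m L"
      unfolding isomorphic_def by blast
    \<comment> \<open>This triple is mapped to a diagonal triple of \<open>prolong m L'\<close>,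
      whose symbol can only be \<open>Suc m\<close>. Because \<alpha> acts on symbols as well, it
      fixes \<open>Suc m\<close> and restricts to the old points.\<close>
    have "(Suc m, Suc m, Suc m) \<in> prolong m L" by (simp add: mem_prolong)
    then have "(\<alpha> (Suc m), \<alpha> (Suc m), \<alpha> (Suc m)) \<in> prolong m L'"
      using mem_isotopism_image_iff[of \<alpha> \<alpha> \<alpha>] permutes_inj[OF \<alpha>(1)] \<alpha>(2) by blast
    then have "\<alpha> (Suc m) = Suc m" by (simp add: mem_prolong)
    then have \<alpha>m: "\<alpha> permutes {1..m}"
      using permutes_superset[OF \<alpha>(1), of "{1..m}"] by (auto simp: le_Suc_eq)
    have "L' = contract m (prolong m (isotopism \<alpha> \<alpha> \<alpha> ` L))"
      using contract_prolong[OF L'] \<alpha>(2) prolong_isotopism[OF \<alpha>m] by simp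
    also have "\<dots> = isotopism \<alpha> \<alpha> \<alpha> ` L"
      by (rule contract_prolong[OF latin_square_isotopism[OF L \<alpha>m \<alpha>m \<alpha>m]])
    finally show "(L, L') \<in> isomorphic m"
      unfolding isomorphic_def using L L' \<alpha>m by blast
  qed
next
  fix K assume "K \<in> {L. latin_square (Suc m) L}" and su: "symmetric_ls K \<and> unipotent_ls K"
  then have K: "latin_square (Suc m) K" by blast
  have one: "1 \<in> {1..Suc m}" by simp
  obtain d where d: "(1, 1, d) \<in> K" using latin_square_symbol_exists[OF K one one] by blast
  \<comment> \<open>Makes \<open>Suc m\<close> the diagonal symbol. It is applied to all three
    coordinates, so the isomorphism class is kept.\<close>
  define \<tau> where "\<tau> = transpose d (Suc m)"
  have \<tau>: "\<tau> permutes {1..Suc m}"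
    unfolding \<tau>_def by (rule permutes_swap_id) (use latin_square_bounds(3)[OF K d] in auto)
  define K' where "K' = isotopism \<tau> \<tau> \<tau> ` K"
  have K': "latin_square (Suc m) K'" "symmetric_ls K'" "unipotent_ls K'"
    unfolding K'_def using latin_square_isotopism[OF K \<tau> \<tau> \<tau>] symmetric_ls_isotopism
      unipotent_ls_isotopism[OF _ permutes_inj[OF \<tau>]] su by auto
  have "(\<tau> 1, \<tau> 1, \<tau> d) \<in> K'"
    unfolding K'_def using mem_isotopism_image_iff[of \<tau> \<tau> \<tau>] permutes_inj[OF \<tau>] d by blast
  moreover obtain t where t: "(1, 1, t) \<in> K'" using latin_square_symbol_exists[OF K'(1) one one] by blast
  ultimately have "t = Suc m" using unipotent_lsD[OF K'(3), of 1 t "\<tau> 1"] by (simp add: \<tau>_def)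
  note C = prolong_contract[OF K' t[unfolded this]]
  have "K = isotopism \<tau> \<tau> \<tau> ` K'"
    unfolding K'_def isotopism_image_compose by (simp add: \<tau>_def isotopism_id)
  then have "(K', K) \<in> isomorphic (Suc m)"
    unfolding isomorphic_def using K K'(1) \<tau> by blast
  then show "\<exists>L\<in>{L. latin_square m L}. symmetric_ls L \<and> (prolong m L, K) \<in> isomorphic (Suc m)"
    using C by (intro bexI[of _ "contract m K'"]) auto
qed

section \<open>From idempotent squares to reduced unipotent squares\<close>

text \<open>The last row of a prolonged idempotent square has \<open>j\<close> in each old column
  \<open>j\<close>, and its diagonal symbol is \<open>Suc m\<close>. Exchanging 1 and
  \<open>Suc m\<close> everywhere turns this row into a first row in natural order and the diagonal
  symbol into 1, as reducedness requires.\<close>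

definition swap_prolong :: "nat \<Rightarrow> triple set \<Rightarrow> triple set" where
  "swap_prolong m L =
     isotopism (transpose 1 (Suc m)) (transpose 1 (Suc m)) (transpose 1 (Suc m)) ` prolong m L"

lemma swap_permutes: "transpose 1 (Suc m) permutes {1..Suc m}"
  by (rule permutes_swap_id) auto

lemma mem_swap:
  "(i, j, s) \<in> isotopism (transpose a b) (transpose a b) (transpose a b) ` L \<longleftrightarrow>
    (transpose a b i, transpose a b j, transpose a b s) \<in> L"
  using mem_isotopism_image_iff[of "transpose a b" "transpose a b" "transpose a b"
      "transpose a b i" "transpose a b j" "transpose a b s" L]
  by simp

lemma swap_swap:
  "isotopism (transpose a b) (transpose a b) (transpose a b) `
    isotopism (transpose a b) (transpose a b) (transpose a b) ` L = L"
  unfolding isotopism_image_compose by (simp add: isotopism_id)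

lemma bij_betw_swap_prolong:
  assumes m: "odd m"
  shows "bij_betw (swap_prolong m)
    {L. latin_square m L \<and> symmetric_ls L \<and> idempotent_ls m L}
    {L. latin_square (Suc m) L \<and> symmetric_ls L \<and> unipotent_ls L \<and> reduced_ls (Suc m) L}"
proof -
  define \<tau> where "\<tau> = transpose 1 (Suc m)"
  have \<tau>: "\<tau> permutes {1..Suc m}" unfolding \<tau>_def by (rule swap_permutes)
  have \<tau>1: "\<tau> 1 = Suc m" "\<tau> (Suc m) = 1" by (simp_all add: \<tau>_def)
  have in\<tau>: "\<tau> i \<in> {1..Suc m} \<longleftrightarrow> i \<in> {1..Suc m}" for i by (rule permutes_in_image[OF \<tau>])
  have mem: "(i, j, s) \<in> isotopism \<tau> \<tau> \<tau> ` L \<longleftrightarrow> (\<tau> i, \<tau> j, \<tau> s) \<in> L" for i j s L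
    unfolding \<tau>_def by (rule mem_swap)
  have sw: "isotopism \<tau> \<tau> \<tau> ` isotopism \<tau> \<tau> \<tau> ` L = L" for L
    unfolding \<tau>_def by (rule swap_swap)
  have sp: "swap_prolong m L = isotopism \<tau> \<tau> \<tau> ` prolong m L" for L
    unfolding swap_prolong_def \<tau>_def ..
  show ?thesis
    unfolding sp
  proof (rule bij_betw_byWitness[where f' = "\<lambda>K. contract m (isotopism \<tau> \<tau> \<tau> ` K)"])
    show "\<forall>L\<in>{L. latin_square m L \<and> symmetric_ls L \<and> idempotent_ls m L}.
        contract m (isotopism \<tau> \<tau> \<tau> ` isotopism \<tau> \<tau> \<tau> ` prolong m L) = L"
      unfolding sw using contract_prolong by blast
  next
    have recovered: "latin_square m (contract m (isotopism \<tau> \<tau> \<tau> ` K)) \<and>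
        symmetric_ls (contract m (isotopism \<tau> \<tau> \<tau> ` K)) \<and>
        prolong m (contract m (isotopism \<tau> \<tau> \<tau> ` K)) = isotopism \<tau> \<tau> \<tau> ` K"
      if K: "latin_square (Suc m) K" "symmetric_ls K" "unipotent_ls K" "reduced_ls (Suc m) K" for K
    proof -
      have "(\<tau> 1, \<tau> 1, 1) \<in> K"
        using reduced_unipotent_diagonal[OF K(1,4,3), of "\<tau> 1" 1] \<tau>1 by simp
      then have "(1, 1, Suc m) \<in> isotopism \<tau> \<tau> \<tau> ` K" unfolding mem \<tau>1(2) .
      with K show ?thesis
        using prolong_contract[OF latin_square_isotopism[OF K(1) \<tau> \<tau> \<tau>] symmetric_ls_isotopism
            unipotent_ls_isotopism[OF _ permutes_inj[OF \<tau>]]] by blast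
    qed
    then show "\<forall>K\<in>{L. latin_square (Suc m) L \<and> symmetric_ls L \<and> unipotent_ls L \<and> reduced_ls (Suc m) L}.
        isotopism \<tau> \<tau> \<tau> ` prolong m (contract m (isotopism \<tau> \<tau> \<tau> ` K)) = K"
      using sw by simp
    have "idempotent_ls m (contract m (isotopism \<tau> \<tau> \<tau> ` K))"
      if K: "reduced_ls (Suc m) K" for K
      unfolding idempotent_ls_def mem_contract
    proof (intro ballI conjI)
      fix i assume i: "i \<in> {1..m}"
      then have "\<tau> i \<in> {1..Suc m}" unfolding in\<tau> by simp
      then show "if i = i then (i, Suc m, i) \<in> isotopism \<tau> \<tau> \<tau> ` K else (i, i, i) \<in> isotopism \<tau> \<tau> \<tau> ` K"
        using K unfolding mem reduced_ls_def \<tau>1(2) by simp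
    qed
    then show "(\<lambda>K. contract m (isotopism \<tau> \<tau> \<tau> ` K)) `
        {L. latin_square (Suc m) L \<and> symmetric_ls L \<and> unipotent_ls L \<and> reduced_ls (Suc m) L}
        \<subseteq> {L. latin_square m L \<and> symmetric_ls L \<and> idempotent_ls m L}"
      using recovered by blast
    have "reduced_ls (Suc m) (isotopism \<tau> \<tau> \<tau> ` prolong m L)" if "idempotent_ls m L" for L
      unfolding reduced_ls_def mem \<tau>1(1)
    proof (intro ballI)
      fix i assume "i \<in> {1..Suc m}"
      then have "\<tau> i \<in> {1..Suc m}" unfolding in\<tau> .
      then have "\<tau> i = Suc m \<or> \<tau> i \<in> {1..m}" by auto
      then show "(Suc m, \<tau> i, \<tau> i) \<in> prolong m L \<and> (\<tau> i, Suc m, \<tau> i) \<in> prolong m L"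
        using that unfolding idempotent_ls_def mem_prolong by auto
    qed
    then show "(\<lambda>L. isotopism \<tau> \<tau> \<tau> ` prolong m L) `
        {L. latin_square m L \<and> symmetric_ls L \<and> idempotent_ls m L}
        \<subseteq> {L. latin_square (Suc m) L \<and> symmetric_ls L \<and> unipotent_ls L \<and> reduced_ls (Suc m) L}"
      using latin_square_isotopism[OF latin_square_prolong \<tau> \<tau> \<tau>] m
        symmetric_ls_isotopism[OF symmetric_ls_prolong]
        unipotent_ls_isotopism[OF unipotent_ls_prolong permutes_inj[OF \<tau>]] by blast
  qed
qed

section \<open>Total symmetry\<close>

text \<open>The transpositions (1 2) and (2 3) generate all coordinate permutations. Closure under
  \<sigma> and under its inverse together give equality of the image with \<open>L\<close>.\<close>

lemma totally_symmetric_ls_iff: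
  "totally_symmetric_ls L \<longleftrightarrow> symmetric_ls L \<and> (\<forall>i j s. (i, j, s) \<in> L \<longrightarrow> (i, s, j) \<in> L)"
proof
  assume ts: "totally_symmetric_ls L"
  have "transpose 1 2 permutes {1, 2, 3::nat}" "transpose 2 3 permutes {1, 2, 3::nat}"
    by (rule permutes_swap_id; simp)+
  then have eq: "permute_coords (transpose 1 2) ` L = L" "permute_coords (transpose 2 3) ` L = L"
    using ts unfolding totally_symmetric_ls_def by blast+
  have perm: "permute_coords (transpose 1 2) (i, j, s) = (j, i, s)"
    "permute_coords (transpose 2 3) (i, j, s) = (i, s, j)" for i j s
    by (simp_all add: permute_coords_def coord_def transpose_def)
  have "(j, i, s) \<in> L \<and> (i, s, j) \<in> L" if "(i, j, s) \<in> L" for i j s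
    using imageI[OF that, of "permute_coords (transpose 1 2)"]
      imageI[OF that, of "permute_coords (transpose 2 3)"] unfolding eq perm by blast
  then show "symmetric_ls L \<and> (\<forall>i j s. (i, j, s) \<in> L \<longrightarrow> (i, s, j) \<in> L)"
    unfolding symmetric_ls_iff by blast
next
  assume "symmetric_ls L \<and> (\<forall>i j s. (i, j, s) \<in> L \<longrightarrow> (i, s, j) \<in> L)"
  then have 1: "(j, i, s) \<in> L" and 2: "(i, s, j) \<in> L" if "(i, j, s) \<in> L" for i j s
    using that symmetric_lsD by blast+
  have closed: "permute_coords \<sigma> t \<in> L" if \<sigma>: "\<sigma> permutes {1, 2, 3}" and t: "t \<in> L" for \<sigma> t
  proof -
    obtain i j s where t_eq: "t = (i, j, s)" by (cases t)
    note a = t[unfolded t_eq]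
    note b = 1[OF a] 2[OF a] 1[OF 2[OF a]] 2[OF 1[OF a]] 2[OF 1[OF 2[OF a]]]
    show ?thesis
      using permutes_123_cases[OF \<sigma>]
      by (elim insertE emptyE)
        (use a b in \<open>simp_all add: t_eq permute_coords_def coord_def transpose_def\<close>)
  qed
  show "totally_symmetric_ls L"
    unfolding totally_symmetric_ls_def
  proof (intro allI impI equalityI subsetI)
    fix \<sigma> t assume \<sigma>: "\<sigma> permutes {1, 2, 3::nat}"
    show "t \<in> L" if "t \<in> permute_coords \<sigma> ` L" using that closed[OF \<sigma>] by blast
    assume "t \<in> L"
    then have "permute_coords (inv \<sigma>) t \<in> L" by (rule closed[OF permutes_inv[OF \<sigma>]])
    moreover have "permute_coords \<sigma> (permute_coords (inv \<sigma>) t) = t"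
      unfolding permute_coords_compose[OF \<sigma>] permutes_inv_o(2)[OF \<sigma>] by (rule permute_coords_id)
    ultimately show "t \<in> permute_coords \<sigma> ` L" by (metis imageI)
  qed
qed

text \<open>The classical passage between Steiner quasigroups and Steiner loops. Idempotence makes
  the moved triples \<open>(i, Suc m, i)\<close> and \<open>(Suc m, i, i)\<close>, which with the
  new \<open>(i, i, Suc m)\<close> form a full orbit of coordinate permutations. The remaining
  triples are common to both squares.\<close>

lemma totally_symmetric_ls_prolong:
  assumes L: "latin_square m L" and idem: "idempotent_ls m L"
  shows "totally_symmetric_ls (prolong m L) \<longleftrightarrow> totally_symmetric_ls L"
proof -
  have diag: "(i, i, s) \<in> L \<longleftrightarrow> i \<in> {1..m} \<and> s = i" for i s
    using idem latin_square_symbol_unique[OF L, of i i] latin_square_bounds(1)[OF L, of i i s]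
    unfolding idempotent_ls_def by blast
  have mem: "(i, j, s) \<in> L \<longleftrightarrow> i \<in> {1..m} \<and> j \<in> {1..m} \<and>
      (if i = j then s = i else (i, j, s) \<in> prolong m L)" for i j s
    using diag[of i s] latin_square_bounds[OF L, of i j s] unfolding mem_prolong by auto
  have bnd: "i \<noteq> Suc m" "j \<noteq> Suc m" "s \<noteq> Suc m" if "(i, j, s) \<in> L" for i j s
    using latin_square_bounds[OF L that] by auto
  show ?thesis
  proof
    assume ts: "totally_symmetric_ls (prolong m L)"
    then have P: "(j, i, s) \<in> prolong m L" "(i, s, j) \<in> prolong m L" if "(i, j, s) \<in> prolong m L" for i j s
      using that symmetric_lsD unfolding totally_symmetric_ls_iff by blast+
    have "(j, i, s) \<in> L \<and> (i, s, j) \<in> L" if a: "(i, j, s) \<in> L" for i j s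
    proof (cases "i = j")
      case True
      then show ?thesis using a diag by simp
    next
      case False
      have p: "(i, j, s) \<in> prolong m L" using a False mem[of i j s] by simp
      \<comment> \<open>If \<open>s\<close> were \<open>i\<close>, permuting coordinates would put
        \<open>j\<close> on the diagonal of the prolonged square, where only \<open>Suc m\<close>
        occurs.\<close>
      have "i \<noteq> s"
        using P(2)[OF p] bnd(2)[OF a] by (auto simp: mem_prolong)
      then show ?thesis
        using P[OF p] False latin_square_bounds[OF L a] mem by simp
    qed
    then show "totally_symmetric_ls L"
      unfolding totally_symmetric_ls_iff symmetric_ls_iff by blast
  next
    assume ts: "totally_symmetric_ls L"
    then have T: "(i, s, j) \<in> L" if "(i, j, s) \<in> L" for i j s
      using that unfolding totally_symmetric_ls_iff by blast
    have "(i, s, j) \<in> prolong m L" if p: "(i, j, s) \<in> prolong m L" for i j s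
    proof (cases "i = j \<or> i = Suc m \<or> j = Suc m")
      case True
      then show ?thesis
        using p unfolding mem_prolong by (auto simp: diag split: if_splits)
    next
      case False
      then have a: "(i, j, s) \<in> L" using p by (simp add: mem_prolong)
      have "i \<noteq> s" using T[OF a] diag[of i j] False by auto
      then show ?thesis using T[OF a] bnd[OF a] by (simp add: mem_prolong)
    qed
    then show "totally_symmetric_ls (prolong m L)"
      using symmetric_ls_prolong ts unfolding totally_symmetric_ls_iff by blast
  qed
qed

lemma totally_symmetric_ls_swap_prolong:
  assumes "latin_square m L" "idempotent_ls m L"
  shows "totally_symmetric_ls (swap_prolong m L) \<longleftrightarrow> totally_symmetric_ls L"
proof -
  have iso: "totally_symmetric_ls (isotopism \<alpha> \<alpha> \<alpha> ` K)" if "totally_symmetric_ls K" for \<alpha> K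
    unfolding totally_symmetric_ls_iff
  proof (intro conjI allI impI)
    show "symmetric_ls (isotopism \<alpha> \<alpha> \<alpha> ` K)"
      using that symmetric_ls_isotopism unfolding totally_symmetric_ls_iff by blast
    fix i j s assume "(i, j, s) \<in> isotopism \<alpha> \<alpha> \<alpha> ` K"
    then obtain i' j' s' where *: "(i', j', s') \<in> K" "i = \<alpha> i'" "j = \<alpha> j'" "s = \<alpha> s'"
      by (auto simp: isotopism_def)
    then have "(i', s', j') \<in> K" using that unfolding totally_symmetric_ls_iff by blast
    then show "(i, s, j) \<in> isotopism \<alpha> \<alpha> \<alpha> ` K"
      by (rule rev_image_eqI) (simp add: isotopism_def *)
  qed
  have "totally_symmetric_ls (swap_prolong m L) \<longleftrightarrow> totally_symmetric_ls (prolong m L)"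
    using iso swap_swap unfolding swap_prolong_def by metis
  then show ?thesis using totally_symmetric_ls_prolong[OF assms] by simp
qed

section \<open>The counting identities\<close>

lemma card_symmetric_unipotent_reduced:
  assumes "odd m"
  shows "card {L. latin_square (Suc m) L \<and> symmetric_ls L \<and> unipotent_ls L \<and> reduced_ls (Suc m) L}
    = card {L. latin_square m L \<and> symmetric_ls L \<and> idempotent_ls m L}"
  using bij_betw_same_card[OF bij_betw_swap_prolong[OF assms]] by simp

lemma card_totally_symmetric_unipotent_reduced:
  assumes "odd m"
  shows "card {L. latin_square (Suc m) L \<and> totally_symmetric_ls L \<and> unipotent_ls L \<and> reduced_ls (Suc m) L}
    = card {L. latin_square m L \<and> totally_symmetric_ls L \<and> idempotent_ls m L}"
proof -
  let ?A = "{L. latin_square m L \<and> symmetric_ls L \<and> idempotent_ls m L}"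
  let ?B = "{L. latin_square (Suc m) L \<and> symmetric_ls L \<and> unipotent_ls L \<and> reduced_ls (Suc m) L}"
  have inj: "inj_on (swap_prolong m) ?A" and im: "swap_prolong m ` ?A = ?B"
    using bij_betw_swap_prolong[OF assms] unfolding bij_betw_def by auto
  have ts: "totally_symmetric_ls (swap_prolong m L) \<longleftrightarrow> totally_symmetric_ls L" if "L \<in> ?A" for L
    using that totally_symmetric_ls_swap_prolong by blast
  have "swap_prolong m ` {L \<in> ?A. totally_symmetric_ls L} = {L \<in> ?B. totally_symmetric_ls L}"
    unfolding im[symmetric] using ts by blast
  moreover have "card (swap_prolong m ` {L \<in> ?A. totally_symmetric_ls L}) = card {L \<in> ?A. totally_symmetric_ls L}"
    by (rule card_image, rule inj_on_subset[OF inj]) blast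
  ultimately have "card {L \<in> ?B. totally_symmetric_ls L} = card {L \<in> ?A. totally_symmetric_ls L}"
    by (simp only:)
  moreover have "{L \<in> ?B. totally_symmetric_ls L} =
    {L. latin_square (Suc m) L \<and> totally_symmetric_ls L \<and> unipotent_ls L \<and> reduced_ls (Suc m) L}"
    "{L \<in> ?A. totally_symmetric_ls L} = {L. latin_square m L \<and> totally_symmetric_ls L \<and> idempotent_ls m L}"
    unfolding totally_symmetric_ls_iff by blast+
  ultimately show ?thesis by simp
qed

lemma card_eq_fact_mult_card_reduced:
  assumes X: "\<And>L. L \<in> X \<Longrightarrow> latin_square n L \<and> symmetric_ls L" and n: "n > 0"
    and closed: "\<And>L \<gamma>. L \<in> X \<Longrightarrow> \<gamma> permutes {1..n} \<Longrightarrow> isotopism id id \<gamma> ` L \<in> X"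
  shows "card X = fact n * card {L \<in> X. reduced_ls n L}"
proof -
  have one: "1 \<in> {1..n}" using n by simp
  have "card X = fact n * card {L \<in> X. \<forall>i\<in>{1..n}. (1, i, i) \<in> L}"
  proof (rule card_eq_fact_mult_card_normalised)
    fix L s assume L: "L \<in> X" and s: "s \<in> {1..n}"
    then show "\<exists>i\<in>{1..n}. (1, i, s) \<in> L"
      using latin_square_column_exists[OF _ one s, of L] latin_square_bounds(2)[of n L] X[OF L] by blast
  qed (use X closed one in blast)+
  also have "{L \<in> X. \<forall>i\<in>{1..n}. (1, i, i) \<in> L} = {L \<in> X. reduced_ls n L}"
    unfolding reduced_ls_def using X symmetric_lsD by blast
  finally show ?thesis .
qed

text \<open>All symmetric squares of odd order are counted twice, normalised along the first row and
  along the diagonal; both counts carry the factor m!, which cancels.\<close>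

lemma card_symmetric_idempotent:
  assumes m: "odd m"
  shows "card {L. latin_square m L \<and> symmetric_ls L \<and> idempotent_ls m L}
    = card {L. latin_square m L \<and> symmetric_ls L \<and> reduced_ls m L}"
proof -
  let ?X = "{L. latin_square m L \<and> symmetric_ls L}"
  have closed: "isotopism id id \<gamma> ` L \<in> ?X" if "L \<in> ?X" "\<gamma> permutes {1..m}" for L \<gamma>
    using that latin_square_isotopism[OF _ permutes_id permutes_id that(2)] symmetric_ls_isotopism
    by blast
  have "card ?X = fact m * card {L \<in> ?X. reduced_ls m L}"
    by (rule card_eq_fact_mult_card_reduced[OF _ odd_pos[OF m] closed]) blast
  moreover have "card ?X = fact m * card {L \<in> ?X. \<forall>i\<in>{1..m}. (i, i, i) \<in> L}"
    by (rule card_eq_fact_mult_card_normalised[OF _ closed])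
      (use odd_symmetric_diagonal_exists m in blast)+
  ultimately have "card {L \<in> ?X. \<forall>i\<in>{1..m}. (i, i, i) \<in> L} = card {L \<in> ?X. reduced_ls m L}"
    by simp
  then show ?thesis by (simp only: idempotent_ls_def mem_Collect_eq conj_assoc)
qed

lemma card_symmetric_unipotent:
  assumes "n > 0"
  shows "card {L. latin_square n L \<and> symmetric_ls L \<and> unipotent_ls L}
    = fact n * card {L. latin_square n L \<and> symmetric_ls L \<and> unipotent_ls L \<and> reduced_ls n L}"
proof -
  let ?X = "{L. latin_square n L \<and> symmetric_ls L \<and> unipotent_ls L}"
  have "card ?X = fact n * card {L \<in> ?X. reduced_ls n L}"
  proof (rule card_eq_fact_mult_card_reduced[OF _ assms])
    fix L \<gamma> assume "L \<in> ?X" "\<gamma> permutes {1..n}"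
    then show "isotopism id id \<gamma> ` L \<in> ?X"
      using latin_square_isotopism[OF _ permutes_id permutes_id] symmetric_ls_isotopism
        unipotent_ls_isotopism[OF _ inj_on_id] by blast
  qed blast
  then show ?thesis by (simp only: mem_Collect_eq conj_assoc)
qed

section \<open>One-factorisations\<close>

definition symbol_matching :: "triple set \<Rightarrow> nat \<Rightarrow> nat set set" where
  "symbol_matching L s = {{i, j} |i j. i \<noteq> j \<and> (i, j, s) \<in> L}"

text \<open>Removing the empty set discards the symbols that do not occur off the diagonal.\<close>

definition factorisation :: "triple set \<Rightarrow> nat set set set" where
  "factorisation L = range (symbol_matching L) - {{}}"

lemma mem_symbol_matching:
  assumes "symmetric_ls L"
  shows "{i, j} \<in> symbol_matching L s \<longleftrightarrow> i \<noteq> j \<and> (i, j, s) \<in> L"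
proof
  assume "{i, j} \<in> symbol_matching L s"
  then obtain a b where ab: "{i, j} = {a, b}" "a \<noteq> b" "(a, b, s) \<in> L"
    unfolding symbol_matching_def by blast
  then show "i \<noteq> j \<and> (i, j, s) \<in> L"
    using symmetric_lsD[OF assms ab(3)] by (auto simp: doubleton_eq_iff)
qed (auto simp: symbol_matching_def)

lemma symbol_matchingE:
  assumes "e \<in> symbol_matching L s"
  obtains i j where "e = {i, j}" "i \<noteq> j" "(i, j, s) \<in> L"
  using assms unfolding symbol_matching_def by blast

text \<open>Each edge lies in one matching because each cell holds one symbol. A vertex
  \<open>v\<close> is covered once by symbol \<open>s\<close> because \<open>s\<close> occurs once
  in row \<open>v\<close>, in a column other than \<open>v\<close> when \<open>s\<close> is not the
  diagonal symbol.\<close>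

lemma one_factorisation_factorisation:
  assumes L: "latin_square n L" and sym: "symmetric_ls L" and uni: "unipotent_ls L"
  shows "one_factorisation n (factorisation L)"
proof -
  note mem = mem_symbol_matching[OF sym]
  have edge: "symbol_matching L s \<subseteq> complete_graph_edges n" for s
  proof
    fix e assume "e \<in> symbol_matching L s"
    then obtain i j where e: "e = {i, j}" "i \<noteq> j" "(i, j, s) \<in> L" by (rule symbol_matchingE)
    then show "e \<in> complete_graph_edges n"
      using latin_square_bounds(1,2)[OF L e(3)] unfolding complete_graph_edges_def by auto
  qed
  have "partition_on (complete_graph_edges n) (factorisation L)"
  proof (rule partition_onI)
    show "\<Union>(factorisation L) = complete_graph_edges n"
    proof (intro equalityI subsetI)
      fix e assume "e \<in> \<Union>(factorisation L)"
      then show "e \<in> complete_graph_edges n" using edge unfolding factorisation_def by blast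
    next
      fix e assume "e \<in> complete_graph_edges n"
      then have e: "e \<subseteq> {1..n}" "card e = 2" unfolding complete_graph_edges_def by auto
      then obtain i j where ij: "e = {i, j}" "i \<noteq> j" by (auto simp: card_2_iff)
      then have "i \<in> {1..n}" "j \<in> {1..n}" using e(1) by auto
      then obtain s where "(i, j, s) \<in> L" using latin_square_symbol_exists[OF L] by blast
      then have "e \<in> symbol_matching L s" using mem ij by simp
      then show "e \<in> \<Union>(factorisation L)" unfolding factorisation_def by blast
    qed
  next
    fix M M' assume M: "M \<in> factorisation L" "M' \<in> factorisation L" "M \<noteq> M'"
    then obtain s s' where s: "M = symbol_matching L s" "M' = symbol_matching L s'"
      unfolding factorisation_def by blast
    have False if "e \<in> M" "e \<in> M'" for e
    proof -
      obtain i j where ij: "e = {i, j}" "i \<noteq> j" "(i, j, s) \<in> L"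
        using \<open>e \<in> M\<close> unfolding s by (rule symbol_matchingE)
      then have "(i, j, s') \<in> L" using \<open>e \<in> M'\<close> mem unfolding s by simp
      then have "s = s'" using latin_square_symbol_unique[OF L ij(3)] by blast
      then show False using M(3) s by simp
    qed
    then show "disjnt M M'" unfolding disjnt_def by blast
  qed (simp add: factorisation_def)
  moreover have "perfect_matching n M" if M: "M \<in> factorisation L" for M
  proof -
    obtain s where s: "M = symbol_matching L s" "M \<noteq> {}"
      using M unfolding factorisation_def by blast
    then obtain e where "e \<in> symbol_matching L s" by blast
    then obtain a b where ab: "a \<noteq> b" "(a, b, s) \<in> L" by (rule symbol_matchingE)
    note sM = latin_square_bounds(3)[OF L ab(2)] latin_square_bounds(1)[OF L ab(2)]
    \<comment> \<open>Were \<open>s\<close> the diagonal symbol, row \<open>a\<close> would contain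
      it in columns \<open>a\<close> and \<open>b\<close>.\<close>
    have off: "(v, v, s) \<notin> L" for v
    proof
      assume v: "(v, v, s) \<in> L"
      obtain t where t: "(a, a, t) \<in> L" using latin_square_symbol_exists[OF L sM(2) sM(2)] by blast
      then have "(a, a, s) \<in> L" using unipotent_lsD[OF uni v t] by simp
      then show False using latin_square_column_unique[OF L ab(2)] ab(1) by metis
    qed
    have "\<exists>!e. e \<in> M \<and> v \<in> e" if v: "v \<in> {1..n}" for v
    proof -
      obtain j where j: "(v, j, s) \<in> L" using latin_square_column_exists[OF L v sM(1)] by blast
      show ?thesis
      proof (rule ex1I)
        show "{v, j} \<in> M \<and> v \<in> {v, j}" using j off[of v] unfolding s mem by auto
        fix e assume e: "e \<in> M \<and> v \<in> e"
        then obtain x y where xy: "e = {x, y}" "x \<noteq> y" "(x, y, s) \<in> L"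
          unfolding s using symbol_matchingE by metis
        have "v = x \<or> v = y" using e xy(1) by blast
        then show "e = {v, j}"
        proof
          assume "v = x"
          then show ?thesis using latin_square_column_unique[OF L j, of y] xy by simp
        next
          assume "v = y"
          then show ?thesis
            using latin_square_column_unique[OF L j, of x] symmetric_lsD[OF sym xy(3)] xy(1)
            by (simp add: insert_commute)
        qed
      qed
    qed
    then show ?thesis unfolding perfect_matching_def s(1) using edge by blast
  qed
  ultimately show ?thesis unfolding one_factorisation_def by blast
qed

definition map_factorisation :: "(nat \<Rightarrow> nat) \<Rightarrow> nat set set set \<Rightarrow> nat set set set" where
  "map_factorisation \<phi> F = (\<lambda>M. (\<lambda>e. \<phi> ` e) ` M) ` F"

lemma map_factorisation_compose:
  "map_factorisation \<phi> (map_factorisation \<psi> F) = map_factorisation (\<phi> \<circ> \<psi>) F"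
  by (simp add: map_factorisation_def image_image)

lemma map_factorisation_id: "map_factorisation id F = F"
  by (simp add: map_factorisation_def)

text \<open>\<gamma> merely renames the matchings, and a factorisation forgets their names; only the
  action of \<alpha> on vertices remains.\<close>

lemma factorisation_isotopism:
  assumes \<alpha>: "inj \<alpha>" and \<gamma>: "bij \<gamma>"
  shows "factorisation (isotopism \<alpha> \<alpha> \<gamma> ` L) = map_factorisation \<alpha> (factorisation L)"
proof -
  let ?K = "isotopism \<alpha> \<alpha> \<gamma> ` L"
  have fac: "symbol_matching ?K (\<gamma> s) = (\<lambda>e. \<alpha> ` e) ` symbol_matching L s" for s
  proof (intro equalityI subsetI)
    fix e assume "e \<in> symbol_matching ?K (\<gamma> s)"
    then obtain i j where ij: "e = {i, j}" "i \<noteq> j" "(i, j, \<gamma> s) \<in> ?K" by (rule symbol_matchingE)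
    then obtain i' j' s' where "i = \<alpha> i'" "j = \<alpha> j'" "\<gamma> s = \<gamma> s'" "(i', j', s') \<in> L"
      by (auto simp: isotopism_def)
    moreover from this have "s' = s" using bij_is_inj[OF \<gamma>] by (simp add: inj_eq)
    ultimately have "e = \<alpha> ` {i', j'}" "{i', j'} \<in> symbol_matching L s"
      using ij by (auto simp: symbol_matching_def)
    then show "e \<in> (\<lambda>e. \<alpha> ` e) ` symbol_matching L s" by blast
  next
    fix e assume "e \<in> (\<lambda>e. \<alpha> ` e) ` symbol_matching L s"
    then obtain e' where e': "e = \<alpha> ` e'" "e' \<in> symbol_matching L s" by blast
    obtain i j where ij: "e' = {i, j}" "i \<noteq> j" "(i, j, s) \<in> L"
      using e'(2) by (rule symbol_matchingE)
    have "(\<alpha> i, \<alpha> j, \<gamma> s) \<in> ?K"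
      using mem_isotopism_image_iff[OF \<alpha> \<alpha> bij_is_inj[OF \<gamma>]] ij(3) by blast
    moreover have "\<alpha> i \<noteq> \<alpha> j" using ij(2) \<alpha> by (simp add: inj_eq)
    moreover have "e = {\<alpha> i, \<alpha> j}" using e'(1) ij(1) by simp
    ultimately show "e \<in> symbol_matching ?K (\<gamma> s)" unfolding symbol_matching_def by blast
  qed
  have "range (symbol_matching ?K) = range (\<lambda>s. symbol_matching ?K (\<gamma> s))"
    using bij_is_surj[OF \<gamma>] by (metis image_image)
  also have "\<dots> = (\<lambda>M. (\<lambda>e. \<alpha> ` e) ` M) ` range (symbol_matching L)"
    unfolding fac image_image ..
  finally have "range (symbol_matching ?K) = map_factorisation \<alpha> (range (symbol_matching L))"
    unfolding map_factorisation_def .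
  moreover have "map_factorisation \<alpha> (A - {{}}) = map_factorisation \<alpha> A - {{}}" for A
    unfolding map_factorisation_def by blast
  ultimately show ?thesis
    unfolding factorisation_def by simp
qed

text \<open>In a reduced unipotent square a symbol \<open>s\<close> other than 1 names the matching
  that contains \<open>{1, s}\<close>, so the forgotten names can be read off the
  factorisation.\<close>

lemma reduced_eq_if_factorisation_eq:
  assumes L: "latin_square n L" "symmetric_ls L" "unipotent_ls L" "reduced_ls n L"
    and L': "latin_square n L'" "symmetric_ls L'" "unipotent_ls L'" "reduced_ls n L'"
    and eq: "factorisation L = factorisation L'" and n: "n > 0"
  shows "L = L'"
proof -
  have sub: "(i, j, s) \<in> L'"
    if L: "latin_square n L" "symmetric_ls L" "unipotent_ls L" "reduced_ls n L"
      and L': "latin_square n L'" "symmetric_ls L'" "unipotent_ls L'" "reduced_ls n L'"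
      and eq: "factorisation L = factorisation L'" and s: "(i, j, s) \<in> L" for L L' i j s
  proof (cases "i = j")
    case True
    then show ?thesis
      using s reduced_unipotent_diagonal[OF L(1,4,3) n, of i s]
        reduced_unipotent_diagonal[OF L'(1,4,3) n, of i s] by simp
  next
    case False
    note bnd = latin_square_bounds[OF L(1) s]
    have "(i, i, 1) \<in> L" using reduced_unipotent_diagonal[OF L(1,4,3) n] bnd(1) by blast
    then have "1 \<noteq> s" using latin_square_column_unique[OF L(1) s, of i] False by metis
    have 1: "(1, s, s) \<in> L" "(1, s, s) \<in> L'" using L(4) L'(4) bnd(3) unfolding reduced_ls_def by auto
    have in1: "{1, s} \<in> symbol_matching L s"
      using mem_symbol_matching[OF L(2)] 1(1) \<open>1 \<noteq> s\<close> by blast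
    then have "symbol_matching L s \<in> factorisation L'"
      using eq[symmetric] unfolding factorisation_def by blast
    then obtain s' where s': "symbol_matching L s = symbol_matching L' s'"
      unfolding factorisation_def by blast
    have "(1, s, s') \<in> L'" using in1 mem_symbol_matching[OF L'(2)] unfolding s' by blast
    then have "s' = s" using latin_square_symbol_unique[OF L'(1)] 1(2) by blast
    have "{i, j} \<in> symbol_matching L s" using mem_symbol_matching[OF L(2)] s False by blast
    then show ?thesis using mem_symbol_matching[OF L'(2)] unfolding s' \<open>s' = s\<close> by blast
  qed
  have "(i, j, s) \<in> L \<longleftrightarrow> (i, j, s) \<in> L'" for i j s
    using sub[OF L L' eq] sub[OF L' L eq[symmetric]] by blast
  then show ?thesis by auto
qed

text \<open>A vertex bijection matters only on \<open>{1..n}\<close>, since all edges lie there.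
  Extending it by the identity gives a permutation, for which inverses and composites are
  available.\<close>

lemma one_factorisation_isomorphic_permutes:
  "one_factorisation_isomorphic n = {(F, F'). one_factorisation n F \<and> one_factorisation n F' \<and>
     (\<exists>\<alpha>. \<alpha> permutes {1..n} \<and> F' = map_factorisation \<alpha> F)}"
proof -
  have iff: "(\<exists>\<phi>. bij_betw \<phi> {1..n} {1..n} \<and> F' = (\<lambda>M. (\<lambda>e. \<phi> ` e) ` M) ` F) \<longleftrightarrow>
    (\<exists>\<alpha>. \<alpha> permutes {1..n} \<and> F' = map_factorisation \<alpha> F)" (is "?l \<longleftrightarrow> ?r")
    if F: "one_factorisation n F" for F F'
  proof
    assume ?l
    then obtain \<phi> where \<phi>: "bij_betw \<phi> {1..n} {1..n}" "F' = map_factorisation \<phi> F"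
      unfolding map_factorisation_def by blast
    define \<alpha> where "\<alpha> x = (if x \<in> {1..n} then \<phi> x else x)" for x
    have eq: "\<alpha> x = \<phi> x" if "x \<in> {1..n}" for x
      using that unfolding \<alpha>_def by (simp only: if_True)
    have "bij_betw \<alpha> {1..n} {1..n}"
      using \<phi>(1) bij_betw_cong[of "{1..n}" \<alpha> \<phi> "{1..n}"] eq by blast
    then have "\<alpha> permutes {1..n}"
      by (rule bij_imp_permutes) (simp only: \<alpha>_def if_False)
    moreover have "map_factorisation \<phi> F = map_factorisation \<alpha> F"
      unfolding map_factorisation_def
    proof (intro image_cong refl)
      fix M e x assume "M \<in> F" "e \<in> M" "x \<in> e"
      then have "e \<in> complete_graph_edges n"
        using F unfolding one_factorisation_def perfect_matching_def by blast
      then have "x \<in> {1..n}" using \<open>x \<in> e\<close> unfolding complete_graph_edges_def by blast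
      then show "\<phi> x = \<alpha> x" using eq by simp
    qed
    ultimately show ?r using \<phi>(2) by blast
  next
    assume ?r
    then show ?l unfolding map_factorisation_def using permutes_imp_bij by blast
  qed
  have "(F, F') \<in> one_factorisation_isomorphic n \<longleftrightarrow>
      (F, F') \<in> {(F, F'). one_factorisation n F \<and> one_factorisation n F' \<and>
        (\<exists>\<alpha>. \<alpha> permutes {1..n} \<and> F' = map_factorisation \<alpha> F)}" for F F'
    unfolding one_factorisation_isomorphic_def mem_Collect_eq prod.case using iff[of F F'] by argo
  then show ?thesis
    by (simp only: set_eq_iff split_paired_All simp_thms)
qed

lemma equiv_one_factorisation_isomorphic:
  "equiv {F. one_factorisation n F} (one_factorisation_isomorphic n)"
  unfolding one_factorisation_isomorphic_permutes
proof (rule equiv_restrict)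
  show "\<exists>\<alpha>. \<alpha> permutes {1..n} \<and> F = map_factorisation \<alpha> F" for F
    using permutes_id map_factorisation_id by metis
next
  fix F F' assume "\<exists>\<alpha>. \<alpha> permutes {1..n} \<and> F' = map_factorisation \<alpha> F"
  then obtain \<alpha> where \<alpha>: "\<alpha> permutes {1..n}" "F' = map_factorisation \<alpha> F" by blast
  then have "F = map_factorisation (inv \<alpha>) F'"
    by (simp add: map_factorisation_compose permutes_inv_o map_factorisation_id)
  then show "\<exists>\<alpha>. \<alpha> permutes {1..n} \<and> F = map_factorisation \<alpha> F'"
    using permutes_inv[OF \<alpha>(1)] by blast
next
  fix F F' F'' assume "\<exists>\<alpha>. \<alpha> permutes {1..n} \<and> F' = map_factorisation \<alpha> F"
    "\<exists>\<alpha>. \<alpha> permutes {1..n} \<and> F'' = map_factorisation \<alpha> F'"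
  then show "\<exists>\<alpha>. \<alpha> permutes {1..n} \<and> F'' = map_factorisation \<alpha> F"
    using map_factorisation_compose permutes_compose by metis
qed

text \<open>The matching containing the edge \<open>{1, s}\<close> becomes symbol \<open>s\<close>, so that the square is reduced.\<close>

lemma factorisation_surjective:
  assumes F: "one_factorisation n F" and n: "n > 0"
  obtains L where "latin_square n L" "symmetric_ls L" "unipotent_ls L" "factorisation L = F"
proof -
  \<comment> \<open>Symbol 1 is free for the diagonal, because \<open>{1, s}\<close> is an edge only
    for \<open>s\<close> different from 1.\<close>
  define L where "L = {(i, j, s). i \<in> {1..n} \<and> j \<in> {1..n} \<and> s \<in> {1..n} \<and>
    (if i = j then s = 1 else s \<noteq> 1 \<and> (\<exists>M\<in>F. {i, j} \<in> M \<and> {1, s} \<in> M))}"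
  have mem: "(i, j, s) \<in> L \<longleftrightarrow> i \<in> {1..n} \<and> j \<in> {1..n} \<and> s \<in> {1..n} \<and>
    (if i = j then s = 1 else s \<noteq> 1 \<and> (\<exists>M\<in>F. {i, j} \<in> M \<and> {1, s} \<in> M))" for i j s
    unfolding L_def by blast
  have off: "(i, j, s) \<in> L \<longleftrightarrow> i \<in> {1..n} \<and> j \<in> {1..n} \<and> s \<in> {1..n} \<and> s \<noteq> 1 \<and>
      (\<exists>M\<in>F. {i, j} \<in> M \<and> {1, s} \<in> M)" if "i \<noteq> j" for i j s
    using that mem by simp
  have diag: "(i, i, s) \<in> L \<longleftrightarrow> i \<in> {1..n} \<and> s = 1" for i s
    using mem[of i i s] n by auto
  have one: "1 \<in> {1..n}" using n by simp
  have part: "partition_on (complete_graph_edges n) F" and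
    pm: "\<And>M. M \<in> F \<Longrightarrow> perfect_matching n M"
    using F unfolding one_factorisation_def by auto
  have same: "M = M'" if "M \<in> F" "M' \<in> F" "e \<in> M" "e \<in> M'" for M M' e
    using partition_onD2[OF part] that unfolding disjoint_def by blast
  have ex: "\<exists>M\<in>F. {i, j} \<in> M" if "i \<in> {1..n}" "j \<in> {1..n}" "i \<noteq> j" for i j
  proof -
    have "{i, j} \<in> complete_graph_edges n"
      unfolding complete_graph_edges_def using that by auto
    then show ?thesis using partition_onD1[OF part] by blast
  qed
  have partner: "j = j'" if "M \<in> F" "v \<in> {1..n}" "{v, j} \<in> M" "{v, j'} \<in> M" for M v j j'
  proof -
    have "\<exists>!e. e \<in> M \<and> v \<in> e" using pm[OF that(1)] that(2) unfolding perfect_matching_def by blast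
    then have "{v, j} = {v, j'}" using that(3,4) by blast
    then show ?thesis by (auto simp: doubleton_eq_iff)
  qed
  have edge: "\<exists>i j. e = {i, j} \<and> i \<noteq> j \<and> i \<in> {1..n} \<and> j \<in> {1..n}" if "M \<in> F" "e \<in> M" for M e
  proof -
    have "e \<subseteq> {1..n}" "card e = 2"
      using pm[OF that(1)] that(2) unfolding perfect_matching_def complete_graph_edges_def by auto
    then obtain i j where "e = {i, j}" "i \<noteq> j" by (auto simp: card_2_iff)
    then show ?thesis using \<open>e \<subseteq> {1..n}\<close> by blast
  qed
  have label: "\<exists>s. s \<in> {1..n} \<and> s \<noteq> 1 \<and> {1, s} \<in> M" if M: "M \<in> F" for M
  proof -
    obtain e where e: "e \<in> M" "1 \<in> e" using pm[OF M] one unfolding perfect_matching_def by blast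
    then obtain i j where "e = {i, j}" "i \<noteq> j" "i \<in> {1..n}" "j \<in> {1..n}" using edge[OF M] by blast
    then show ?thesis using e by (auto simp: insert_commute)
  qed
  have sym: "symmetric_ls L"
    unfolding symmetric_ls_iff
  proof (intro allI impI)
    fix i j s assume "(i, j, s) \<in> L"
    then show "(j, i, s) \<in> L"
      unfolding mem insert_commute[of j i "{}"] by (simp split: if_splits)
  qed
  have uni: "unipotent_ls L"
    unfolding unipotent_ls_def diag by blast
  have col: "j = j'" if j: "(i, j, s) \<in> L" and j': "(i, j', s) \<in> L" for i j j' s
  proof (cases "s = 1")
    case True
    then have "i = j" "i = j'" using j j' off by blast+
    then show ?thesis by simp
  next
    case False
    then have ne: "i \<noteq> j" "i \<noteq> j'" using j j' diag by blast+
    obtain M where M: "M \<in> F" "{i, j} \<in> M" "{1, s} \<in> M" using j off[OF ne(1)] by blast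
    obtain M' where M': "M' \<in> F" "{i, j'} \<in> M'" "{1, s} \<in> M'" using j' off[OF ne(2)] by blast
    have "M = M'" using same M M' by blast
    moreover have "i \<in> {1..n}" using j mem by blast
    ultimately show ?thesis using partner M M' by blast
  qed
  have latin: "latin_square n L"
    unfolding latin_square_iff
  proof (intro conjI allI ballI impI)
    fix i j s assume "(i, j, s) \<in> L"
    then show "i \<in> {1..n}" "j \<in> {1..n}" "s \<in> {1..n}" unfolding mem by blast+
  next
    fix i j s s' assume s: "(i, j, s) \<in> L" "(i, j, s') \<in> L"
    show "s = s'"
    proof (cases "i = j")
      case True
      then show ?thesis using s diag by simp
    next
      case False
      obtain M where M: "M \<in> F" "{i, j} \<in> M" "{1, s} \<in> M" using s(1) off[OF False] by blast
      obtain M' where M': "M' \<in> F" "{i, j} \<in> M'" "{1, s'} \<in> M'" using s(2) off[OF False] by blast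
      have "M = M'" using same M M' by blast
      then show ?thesis using partner[OF M(1) one] M M' by blast
    qed
  next
    fix i j j' s assume "(i, j, s) \<in> L" "(i, j', s) \<in> L"
    then show "j = j'" by (rule col)
  next
    fix i i' j s assume "(i, j, s) \<in> L" "(i', j, s) \<in> L"
    then show "i = i'" using col symmetric_lsD[OF sym] by blast
  next
    fix i j assume ij: "i \<in> {1..n}" "j \<in> {1..n}"
    show "\<exists>s. (i, j, s) \<in> L"
    proof (cases "i = j")
      case True
      then show ?thesis using diag ij by blast
    next
      case False
      obtain M where M: "M \<in> F" "{i, j} \<in> M" using ex[OF ij False] by blast
      then show ?thesis using label[OF M(1)] off[OF False] ij by blast
    qed
  qed
  have matching: "symbol_matching L s = M" if M: "M \<in> F" and s: "s \<in> {1..n}" "s \<noteq> 1" "{1, s} \<in> M" for M s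
  proof (intro equalityI subsetI)
    fix e assume "e \<in> symbol_matching L s"
    then obtain i j where ij: "e = {i, j}" "i \<noteq> j" "(i, j, s) \<in> L" by (rule symbol_matchingE)
    then obtain M' where M': "M' \<in> F" "{i, j} \<in> M'" "{1, s} \<in> M'" using off[OF ij(2)] by blast
    have "M' = M" by (rule same[OF M'(1) M M'(3) s(3)])
    then show "e \<in> M" using ij(1) M'(2) by simp
  next
    fix e assume e: "e \<in> M"
    then obtain i j where ij: "e = {i, j}" "i \<noteq> j" "i \<in> {1..n}" "j \<in> {1..n}"
      using edge[OF M] by blast
    then have "(i, j, s) \<in> L" using off[OF ij(2)] e M s by blast
    then show "e \<in> symbol_matching L s" using ij mem_symbol_matching[OF sym] by blast
  qed
  have "factorisation L = F"
  proof (intro equalityI subsetI)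
    fix M assume "M \<in> factorisation L"
    then obtain s where s: "M = symbol_matching L s" "M \<noteq> {}" unfolding factorisation_def by blast
    then obtain e where "e \<in> symbol_matching L s" by blast
    then obtain i j where ij: "i \<noteq> j" "(i, j, s) \<in> L" by (rule symbol_matchingE)
    then obtain M' where M': "M' \<in> F" "{1, s} \<in> M'" using off by blast
    moreover have "s \<in> {1..n}" "s \<noteq> 1" using ij off by blast+
    ultimately have "M = M'" using matching s(1) by blast
    then show "M \<in> F" using M'(1) by simp
  next
    fix M assume M: "M \<in> F"
    then obtain s where s: "s \<in> {1..n}" "s \<noteq> 1" "{1, s} \<in> M" using label by blast
    then have "symbol_matching L s = M" using matching M by blast
    then show "M \<in> factorisation L" using s(3) unfolding factorisation_def by blast
  qed
  then show thesis using that latin sym uni by blast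
qed

section \<open>Squares and one-factorisations up to equivalence\<close>

text \<open>Reducing a square by relabelling preserves both its rrs-class and its factorisation.
  Squares with equal factorisations thus reduce to the same square, so they are
  rrs-isotopic.\<close>

lemma card_rrs_isotopism_classes_eq_card_one_factorisation_classes:
  assumes n: "n > 0"
  shows "card {C \<in> rrs_isotopism_classes n. \<exists>L\<in>C. symmetric_ls L \<and> unipotent_ls L}
    = card (one_factorisation_classes n)"
proof -
  let ?SU = "\<lambda>L. symmetric_ls L \<and> unipotent_ls L"
  note rrs = equiv_rrs_isotopic[of n] and fi = equiv_one_factorisation_isomorphic[of n]
  have reduce: "\<exists>K. (L, K) \<in> rrs_isotopic n \<and> ?SU K \<and> reduced_ls n K \<and> factorisation K = factorisation L"
    if L: "latin_square n L" "?SU L" for L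
  proof -
    obtain \<gamma> where \<gamma>: "\<gamma> permutes {1..n}" "reduced_ls n (isotopism id id \<gamma> ` L)"
      using relabel_to_reduced L n by blast
    have "factorisation (isotopism id id \<gamma> ` L) = factorisation L"
      using factorisation_isotopism[OF inj_on_id permutes_bij[OF \<gamma>(1)], of L]
      by (simp only: map_factorisation_id)
    moreover have "(L, isotopism id id \<gamma> ` L) \<in> rrs_isotopic n"
      unfolding rrs_isotopic_def
      using L(1) latin_square_isotopism[OF L(1) permutes_id permutes_id \<gamma>(1)] \<gamma>(1) permutes_id
      by blast
    ultimately show ?thesis
      using \<gamma>(2) L(2) symmetric_ls_isotopism unipotent_ls_isotopism[OF _ inj_on_id] by blast
  qed
  have rrs_if: "(L, L') \<in> rrs_isotopic n"
    if L: "latin_square n L" "?SU L" and L': "latin_square n L'" "?SU L'"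
      and eq: "factorisation L = factorisation L'" for L L'
  proof -
    obtain K where K: "(L, K) \<in> rrs_isotopic n" "?SU K" "reduced_ls n K" "factorisation K = factorisation L"
      using reduce[OF L] by blast
    obtain K' where K': "(L', K') \<in> rrs_isotopic n" "?SU K'" "reduced_ls n K'" "factorisation K' = factorisation L'"
      using reduce[OF L'] by blast
    have "latin_square n K" "latin_square n K'"
      using K(1) K'(1) unfolding rrs_isotopic_def by auto
    then have "K = K'"
      using reduced_eq_if_factorisation_eq[of n K K'] K K' eq n by simp
    then show ?thesis using K(1) K'(1) rrs by (meson equivE symE transE)
  qed
  have "card {C \<in> rrs_isotopism_classes n. \<exists>L\<in>C. ?SU L}
    = card {C \<in> one_factorisation_classes n. \<exists>F\<in>C. True}"
    unfolding rrs_isotopism_classes_def one_factorisation_classes_def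
  proof (rule card_classes_eq[OF rrs fi, where f = factorisation])
    fix L assume "L \<in> {L. latin_square n L}" "?SU L"
    then show "factorisation L \<in> {F. one_factorisation n F} \<and> True"
      using one_factorisation_factorisation by blast
  next
    fix L L' assume "L \<in> {L. latin_square n L}" "L' \<in> {L. latin_square n L}" and su: "?SU L" "?SU L'"
    then have L: "latin_square n L" and L': "latin_square n L'" by auto
    have of: "one_factorisation n (factorisation L)" "one_factorisation n (factorisation L')"
      using one_factorisation_factorisation L L' su by auto
    show "(L, L') \<in> rrs_isotopic n \<longleftrightarrow>
      (factorisation L, factorisation L') \<in> one_factorisation_isomorphic n"
    proof
      assume "(L, L') \<in> rrs_isotopic n"
      then obtain \<alpha> \<gamma> where p: "\<alpha> permutes {1..n}" "\<gamma> permutes {1..n}" "L' = isotopism \<alpha> \<alpha> \<gamma> ` L"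
        unfolding rrs_isotopic_def by blast
      then have "factorisation L' = map_factorisation \<alpha> (factorisation L)"
        using factorisation_isotopism[OF permutes_inj[OF p(1)] permutes_bij[OF p(2)]] by simp
      then show "(factorisation L, factorisation L') \<in> one_factorisation_isomorphic n"
        unfolding one_factorisation_isomorphic_permutes using of p(1) by blast
    next
      assume "(factorisation L, factorisation L') \<in> one_factorisation_isomorphic n"
      then obtain \<alpha> where \<alpha>: "\<alpha> permutes {1..n}" "factorisation L' = map_factorisation \<alpha> (factorisation L)"
        unfolding one_factorisation_isomorphic_permutes by blast
      \<comment> \<open>Transporting \<open>L\<close> along the isomorphism of factorisations turns
        isomorphism into equality, so \<open>rrs_if\<close> applies.\<close>
      define K where "K = isotopism \<alpha> \<alpha> id ` L"
      have K: "latin_square n K" "?SU K"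
        unfolding K_def using latin_square_isotopism[OF L \<alpha>(1) \<alpha>(1) permutes_id] su(1)
          symmetric_ls_isotopism unipotent_ls_isotopism[OF _ permutes_inj[OF \<alpha>(1)]] by auto
      have "factorisation K = factorisation L'"
        unfolding K_def \<alpha>(2) by (rule factorisation_isotopism[OF permutes_inj[OF \<alpha>(1)] bij_id])
      then have "(K, L') \<in> rrs_isotopic n" by (rule rrs_if[OF K L' su(2)])
      moreover have "(L, K) \<in> rrs_isotopic n"
        unfolding rrs_isotopic_def using L K(1) \<alpha>(1) permutes_id K_def by blast
      ultimately show "(L, L') \<in> rrs_isotopic n" using rrs by (meson equivE transE)
    qed
  next
    fix F assume "F \<in> {F. one_factorisation n F}"
    then have F: "one_factorisation n F" by blast
    then obtain L where L: "latin_square n L" "symmetric_ls L" "unipotent_ls L" "factorisation L = F"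
      using factorisation_surjective n by blast
    have "(F, F) \<in> one_factorisation_isomorphic n"
      using F fi unfolding equiv_def refl_on_def by blast
    then show "\<exists>L\<in>{L. latin_square n L}. ?SU L \<and> (factorisation L, F) \<in> one_factorisation_isomorphic n"
      using L by blast
  qed
  \<comment> \<open>Equivalence classes are non-empty, so the trivial condition on members keeps all
    of them.\<close>
  moreover have "{C \<in> one_factorisation_classes n. \<exists>F\<in>C. True} = one_factorisation_classes n"
    unfolding one_factorisation_classes_def using in_quotient_imp_non_empty[OF fi] by blast
  ultimately show ?thesis by simp
qed

section \<open>Assembly of the eight statements\<close>

theorem theorem8:
  fixes n :: nat
  assumes "even n" and "n > 0"
  shows
    "card {C \<in> species n. \<exists>L\<in>C. symmetric_ls L \<and> unipotent_ls L}
       = card {C \<in> isotopism_classes n. \<exists>L\<in>C. symmetric_ls L \<and> unipotent_ls L}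
     \<and> card {C \<in> rrs_isotopism_classes n. \<exists>L\<in>C. symmetric_ls L \<and> unipotent_ls L}
       = card (one_factorisation_classes n)
     \<and> (n mod 4 = 2 \<longrightarrow>
         card {C \<in> species n. \<exists>L\<in>C. symmetric_ls L \<and> unipotent_ls L}
           = card {C \<in> rrs_isotopism_classes n. \<exists>L\<in>C. symmetric_ls L \<and> unipotent_ls L})
     \<and> (card {L. latin_square n L \<and> symmetric_ls L \<and> unipotent_ls L \<and> reduced_ls n L}
           = card {L. latin_square (n - 1) L \<and> symmetric_ls L \<and> idempotent_ls (n - 1) L}
        \<and> card {L. latin_square (n - 1) L \<and> symmetric_ls L \<and> idempotent_ls (n - 1) L}
           = card {L. latin_square (n - 1) L \<and> symmetric_ls L \<and> reduced_ls (n - 1) L})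
     \<and> card {L. latin_square n L \<and> symmetric_ls L \<and> unipotent_ls L}
       = fact n * card {L. latin_square (n - 1) L \<and> symmetric_ls L \<and> reduced_ls (n - 1) L}
     \<and> card {L. latin_square n L \<and> totally_symmetric_ls L \<and> unipotent_ls L \<and> reduced_ls n L}
       = card {L. latin_square (n - 1) L \<and> totally_symmetric_ls L \<and> idempotent_ls (n - 1) L}
     \<and> card {C \<in> isomorphism_classes n. \<exists>L\<in>C. symmetric_ls L \<and> unipotent_ls L}
       = card {C \<in> isomorphism_classes (n - 1). \<exists>L\<in>C. symmetric_ls L}
     \<and> ((\<forall>C\<in>species n. (\<exists>L\<in>C. symmetric_ls L \<and> unipotent_ls L) \<longrightarrow>
            (\<exists>L\<in>C. symmetric_ls L \<and> unipotent_ls L \<and> reduced_ls n L))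
        \<and> (\<forall>C\<in>isotopism_classes n. (\<exists>L\<in>C. symmetric_ls L \<and> unipotent_ls L) \<longrightarrow>
            (\<exists>L\<in>C. symmetric_ls L \<and> unipotent_ls L \<and> reduced_ls n L))
        \<and> (\<forall>C\<in>rrs_isotopism_classes n. (\<exists>L\<in>C. symmetric_ls L \<and> unipotent_ls L) \<longrightarrow>
            (\<exists>L\<in>C. symmetric_ls L \<and> unipotent_ls L \<and> reduced_ls n L)))"
proof -
  obtain m where m: "n = Suc m" using assms(2) gr0_implies_Suc by blast
  have odd: "odd m" and m': "n - 1 = m" using assms(1) m by auto
  have species: "card {C \<in> species n. \<exists>L\<in>C. symmetric_ls L \<and> unipotent_ls L}
      = card {C \<in> isotopism_classes n. \<exists>L\<in>C. symmetric_ls L \<and> unipotent_ls L}"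
    by (rule card_species_eq_card_isotopism_classes) simp
  have reduced: "card {L. latin_square n L \<and> symmetric_ls L \<and> unipotent_ls L \<and> reduced_ls n L}
      = card {L. latin_square m L \<and> symmetric_ls L \<and> idempotent_ls m L}"
    unfolding m by (rule card_symmetric_unipotent_reduced[OF odd])
  show ?thesis
    unfolding m'
  proof (intro conjI ballI impI)
    show "card {C \<in> species n. \<exists>L\<in>C. symmetric_ls L \<and> unipotent_ls L}
        = card {C \<in> rrs_isotopism_classes n. \<exists>L\<in>C. symmetric_ls L \<and> unipotent_ls L}"
      if "n mod 4 = 2"
      unfolding species by (rule card_isotopism_classes_eq_card_rrs_isotopism_classes[OF that])
    show "card {L. latin_square n L \<and> symmetric_ls L \<and> unipotent_ls L}
        = fact n * card {L. latin_square m L \<and> symmetric_ls L \<and> reduced_ls m L}"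
      \<comment> \<open>Relabelling at order n contributes the factorial; the two equalities of (iv)
        then lead to reduced squares of order m.\<close>
      unfolding card_symmetric_unipotent[OF assms(2)] reduced card_symmetric_idempotent[OF odd] ..
    show "card {L. latin_square n L \<and> totally_symmetric_ls L \<and> unipotent_ls L \<and> reduced_ls n L}
        = card {L. latin_square m L \<and> totally_symmetric_ls L \<and> idempotent_ls m L}"
      unfolding m by (rule card_totally_symmetric_unipotent_reduced[OF odd])
    show "card {C \<in> isomorphism_classes n. \<exists>L\<in>C. symmetric_ls L \<and> unipotent_ls L}
        = card {C \<in> isomorphism_classes m. \<exists>L\<in>C. symmetric_ls L}"
      unfolding m by (rule card_isomorphism_classes_prolong[OF odd, symmetric])
  next
    fix C assume "C \<in> species n" "\<exists>L\<in>C. symmetric_ls L \<and> unipotent_ls L"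
    then show "\<exists>L\<in>C. symmetric_ls L \<and> unipotent_ls L \<and> reduced_ls n L"
      unfolding species_def
      by (rule class_contains_reduced[OF equiv_paratopic
            subset_trans[OF rrs_isotopic_subset_isotopic isotopic_subset_paratopic] assms(2)])
  next
    fix C assume "C \<in> isotopism_classes n" "\<exists>L\<in>C. symmetric_ls L \<and> unipotent_ls L"
    then show "\<exists>L\<in>C. symmetric_ls L \<and> unipotent_ls L \<and> reduced_ls n L"
      unfolding isotopism_classes_def
      by (rule class_contains_reduced[OF equiv_isotopic rrs_isotopic_subset_isotopic assms(2)])
  next
    fix C assume "C \<in> rrs_isotopism_classes n" "\<exists>L\<in>C. symmetric_ls L \<and> unipotent_ls L"
    then show "\<exists>L\<in>C. symmetric_ls L \<and> unipotent_ls L \<and> reduced_ls n L"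
      unfolding rrs_isotopism_classes_def
      by (rule class_contains_reduced[OF equiv_rrs_isotopic subset_refl assms(2)])
  qed (fact species reduced card_symmetric_idempotent[OF odd]
      card_rrs_isotopism_classes_eq_card_one_factorisation_classes[OF assms(2)])+
qed

end
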